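(* Let $n\ge0$, let $S\in\mathbb{Z}^{n\times n}$ be symmetric, positive definite and even, and let $S_0=\begin{pmatrix}0&0&1\\0&-S&0\\1&0&0\end{pmatrix}$, $S_1=\begin{pmatrix}0&0&1\\0&S_0&0\\1&0&0\end{pmatrix}\in\mathbb{Z}^{(n+4)\times(n+4)}$. Let $\Gamma_S=SO^+(S_1;\mathbb{R})\cap\mathbb{Z}^{(n+4)\times(n+4)}$ and $\widetilde{\Gamma}_S=\{M\in\Gamma_S: M\in I+\mathbb{Z}^{(n+4)\times(n+4)}S_1\}$. Let $r\in\mathbb{N}$ and $R\in\mathbb{Z}^{(n+4)\times(n+4)}$ with $\frac{1}{\sqrt r}R\in SO^+(S_1;\mathbb{R})$. Assume that either the lattice $L=\mathbb{Z}^n$ with Gram matrix $S$ is maximal even, or $r$ and $\det S$ are coprime. Then: (a) The right coset $\widetilde{\Gamma}_SR$ contains a matrix of the block form $\begin{pmatrix}\alpha&*&*\\0&*&*\\0&0&\delta\end{pmatrix}$ (blocks of sizes $1,n+2,1$) with $\alpha,\delta\in\mathbb{N}$, $\alpha\delta=r$, where $\alpha$ is the gcd of the entries of the first column of $R$. (b) The double coset $\widetilde{\Gamma}_SR\widetilde{\Gamma}_S$ contains a matrix $R^*=\begin{pmatrix}\alpha^*&0&0\\0&K^*&0\\0&0&\delta^*\end{pmatrix}\in\mathbb{Z}^{(n+4)\times(n+4)}$ (blocks of sizes $1,n+2,1$) with $\alpha^*\in\mathbb{N}$, $\alpha^*\delta^*=r$ and $\frac{1}{\alpha^*}R^*\in\mathbb{Z}^{(n+4)\times(n+4)}$,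 where $\alpha^*$ is the gcd of all the entries of $R$.
   Context: A matrix is even if it is symmetric with even diagonal entries. $SO(S_1;\mathbb{R})=\{M\in SL(n+4;\mathbb{R}): M^{tr}S_1M=S_1\}$ and $SO^+(S_1;\mathbb{R})$ is its identity component. The lattice $L=\mathbb{Z}^n\subset\mathbb{Q}^n$ carries the form $\langle x,y\rangle=x^{tr}Sy$; it is maximal even if there is no lattice $\Lambda\subset\mathbb{Q}^n$ with $\mathbb{Z}^n\subsetneq\Lambda$ and $\langle\lambda,\lambda\rangle\in2\mathbb{Z}$ for all $\lambda\in\Lambda$. $I$ is the identity matrix. *)

theory Defs
  imports
    "HOL-Analysis.Abstract_Topology_2"
    "HOL-Analysis.Function_Topology"
    "Jordan_Normal_Form.Determinant"
begin

text \<open>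
  Matrices and vectors are those of Jordan_Normal_Form, so that the size \<open>n\<close> is an ordinary
  natural number and \<open>n = 0\<close> is allowed. Indices start at 0.
\<close>

abbreviation real_mat :: "int mat \<Rightarrow> real mat" where
  "real_mat \<equiv> map_mat real_of_int"


definition sym_mat :: "'a mat \<Rightarrow> bool" where
  "sym_mat S \<longleftrightarrow> S\<^sup>T = S"

definition even_mat :: "int mat \<Rightarrow> bool" where
  "even_mat S \<longleftrightarrow> sym_mat S \<and> (\<forall>i<dim_row S. even (S $$ (i, i)))"

definition pos_def_mat :: "nat \<Rightarrow> int mat \<Rightarrow> bool" where
  "pos_def_mat n S \<longleftrightarrow>
     (\<forall>x\<in>carrier_vec n. x \<noteq> 0\<^sub>v n \<longrightarrow> x \<bullet> (real_mat S *\<^sub>v x) > 0)"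

text \<open>A lattice in \<open>\<rat>\<^sup>n\<close> is the \<open>\<int>\<close>-span of a basis of \<open>\<rat>\<^sup>n\<close>, i.e. of the columns of an invertible matrix.\<close>

definition rat_lattice :: "nat \<Rightarrow> rat vec set \<Rightarrow> bool" where
  "rat_lattice n \<Lambda> \<longleftrightarrow>
     (\<exists>B\<in>carrier_mat n n. invertible_mat B \<and>
        \<Lambda> = {B *\<^sub>v map_vec rat_of_int z | z. z \<in> carrier_vec n})"

definition std_lattice :: "nat \<Rightarrow> rat vec set" where
  "std_lattice n = {map_vec rat_of_int z | z. z \<in> carrier_vec n}"

definition maximal_even :: "nat \<Rightarrow> int mat \<Rightarrow> bool" where
  "maximal_even n S \<longleftrightarrow>
     \<not> (\<exists>\<Lambda>. rat_lattice n \<Lambda> \<and> std_lattice n \<subset> \<Lambda> \<and>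
          (\<forall>v\<in>\<Lambda>. \<exists>k::int. v \<bullet> (map_mat rat_of_int S *\<^sub>v v) = rat_of_int (2 * k)))"


text \<open>The block matrix with rows \<open>(0, 0, 1)\<close>, \<open>(0, A, 0)\<close>, \<open>(1, 0, 0)\<close>, for a \<open>k \<times> k\<close> matrix \<open>A\<close>.\<close>

definition hyp_ext :: "nat \<Rightarrow> int mat \<Rightarrow> int mat" where
  "hyp_ext k A = mat (k + 2) (k + 2) (\<lambda>(i, j).
     if (i = 0 \<and> j = k + 1) \<or> (i = k + 1 \<and> j = 0) then 1
     else if 1 \<le> i \<and> i \<le> k \<and> 1 \<le> j \<and> j \<le> k then A $$ (i - 1, j - 1)
     else 0)"

definition S0_mat :: "nat \<Rightarrow> int mat \<Rightarrow> int mat" where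
  "S0_mat n S = hyp_ext n (- S)"

definition S1_mat :: "nat \<Rightarrow> int mat \<Rightarrow> int mat" where
  "S1_mat n S = hyp_ext (n + 2) (S0_mat n S)"


text \<open>
  The type of matrices carries no topology in the library; the Euclidean topology on
  \<open>\<real>\<^sup>m\<^sup>\<times>\<^sup>m\<close> is the one pulled back along the entry map.
\<close>

definition mat_topology :: "nat \<Rightarrow> real mat topology" where
  "mat_topology m =
     pullback_topology (carrier_mat m m)
       (\<lambda>M. restrict (\<lambda>p. M $$ p) ({..<m} \<times> {..<m}))
       (product_topology (\<lambda>_. euclideanreal) ({..<m} \<times> {..<m}))"

definition SO_real :: "nat \<Rightarrow> real mat \<Rightarrow> real mat set" where
  "SO_real m A = {M \<in> carrier_mat m m. Determinant.det M = 1 \<and> M\<^sup>T * A * M = A}"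

definition SO_plus :: "nat \<Rightarrow> real mat \<Rightarrow> real mat set" where
  "SO_plus m A = connected_component_of_set (subtopology (mat_topology m) (SO_real m A)) (1\<^sub>m m)"


definition Gamma :: "nat \<Rightarrow> int mat \<Rightarrow> int mat set" where
  "Gamma n S = {M \<in> carrier_mat (n + 4) (n + 4).
     real_mat M \<in> SO_plus (n + 4) (real_mat (S1_mat n S))}"

definition Gamma_tilde :: "nat \<Rightarrow> int mat \<Rightarrow> int mat set" where
  "Gamma_tilde n S = {M \<in> Gamma n S.
     \<exists>X\<in>carrier_mat (n + 4) (n + 4). M = 1\<^sub>m (n + 4) + X * S1_mat n S}"

definition right_coset :: "int mat set \<Rightarrow> int mat \<Rightarrow> int mat set" where
  "right_coset G R = {M * R | M. M \<in> G}"

definition double_coset :: "int mat set \<Rightarrow> int mat \<Rightarrow> int mat set" where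
  "double_coset G R = {M * R * N | M N. M \<in> G \<and> N \<in> G}"

abbreviation scalar_block :: "int \<Rightarrow> int mat" where
  "scalar_block a \<equiv> mat 1 1 (\<lambda>_. a)"

text \<open>Block matrices with rows \<open>(\<alpha>, *, *)\<close>, \<open>(0, *, *)\<close>, \<open>(0, 0, \<delta>)\<close> and blocks of sizes \<open>1, k, 1\<close>.\<close>

definition block_upper :: "nat \<Rightarrow> int \<Rightarrow> int \<Rightarrow> int mat \<Rightarrow> bool" where
  "block_upper k \<alpha> \<delta> P \<longleftrightarrow>
     (\<exists>a\<in>carrier_mat 1 (k + 1). \<exists>K\<in>carrier_mat k k. \<exists>b\<in>carrier_mat k 1.
        P = four_block_mat
              (scalar_block \<alpha>) a
              (0\<^sub>m (k + 1) 1)  (four_block_mat K b (0\<^sub>m 1 k) (scalar_block \<delta>)))"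

end

theory Submission
  imports Defs "HOL-Number_Theory.Number_Theory"
begin

text \<open>
  Let \<open>B\<close> be the bilinear form of \<open>S\<^sub>1\<close>. Eichler transvections
  \<open>x \<mapsto> x - B(a,x) e + B(e,x) a - (B(a,a)/2) B(e,x) e\<close>, with \<open>e\<close> isotropic and orthogonal to \<open>a\<close>,
  act trivially on the discriminant group and depend polynomially on \<open>a\<close>, so they lie in the
  discriminant kernel. Their products move every isotropic \<open>g\<close> with \<open>B(g, \<int>\<^sup>n\<^sup>+\<^sup>4) = \<int>\<close> to the first
  unit vector.

  For (a), divide the first column of \<open>R\<close> by its gcd to get \<open>g\<close>. If \<open>d\<close> divides \<open>B(g, \<int>\<^sup>n\<^sup>+\<^sup>4)\<close>, then
  \<open>d\<close> divides \<open>r\<close>, and \<open>g/d\<close> is an isotropic vector of the dual lattice. Such a vector is integral if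
  \<open>S\<close> is maximal even (otherwise it would generate an even overlattice), and also if \<open>d\<close> is coprime
  to \<open>det S\<close>. So \<open>d = 1\<close>, and once the first column is a multiple of the first unit vector, the
  similitude relation determines the last row.

  For (b), divide \<open>R\<close> by the gcd of its entries. The images of the first unit vector under the
  transvections with \<open>e\<close> the last unit vector span modulo every prime, so by the Chinese remainder
  theorem one of them has primitive image under \<open>R\<close>. Then (a) applies with \<open>\<alpha> = 1\<close> and gives \<open>P\<close>. The
  vector \<open>r P\<^sup>-\<^sup>1 e\<close>, with \<open>e\<close> the last unit vector, is again isotropic in the dual lattice, hence
  integral, and a final transvection that takes \<open>e\<close> to it clears the first row and the last column.
\<close>

section \<open>Bilinear forms\<close>

text \<open>Vectors are functions on the indices, so that sums, multiples and shifted coordinates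
  are plain lambda terms without carrier conditions. By \<open>bform_cong\<close> only the values
  below \<open>m\<close> count.\<close>

definition bform :: "nat \<Rightarrow> 'a::comm_ring_1 mat \<Rightarrow> (nat \<Rightarrow> 'a) \<Rightarrow> (nat \<Rightarrow> 'a) \<Rightarrow> 'a" where
  "bform m G x y = (\<Sum>i<m. \<Sum>j<m. x i * G $$ (i, j) * y j)"

definition unitf :: "nat \<Rightarrow> nat \<Rightarrow> 'a::comm_ring_1" where
  "unitf k i = (if i = k then 1 else 0)"

lemma bform_cong:
  assumes "\<And>i. i < m \<Longrightarrow> x i = x' i" "\<And>i. i < m \<Longrightarrow> y i = y' i"
  shows "bform m G x y = bform m G x' y'"
  unfolding bform_def using assms by (auto intro!: sum.cong)

lemma bform_zero_left [simp]: "bform m G (\<lambda>i. 0) y = 0"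
  and bform_zero_right [simp]: "bform m G y (\<lambda>i. 0) = 0"
  by (simp_all add: bform_def)

lemma bform_linear:
  "bform m G (\<lambda>i. x i + x' i) y = bform m G x y + bform m G x' y"
  "bform m G (\<lambda>i. x i - x' i) y = bform m G x y - bform m G x' y"
  "bform m G x (\<lambda>i. y i + y' i) = bform m G x y + bform m G x y'"
  "bform m G x (\<lambda>i. y i - y' i) = bform m G x y - bform m G x y'"
  by (simp_all add: bform_def algebra_simps sum.distrib sum_subtractf)

lemma bform_scale:
  "bform m G (\<lambda>i. s * x i) y = s * bform m G x y"
  "bform m G (\<lambda>i. x i * s) y = s * bform m G x y"
  "bform m G x (\<lambda>i. s * y i) = s * bform m G x y"
  "bform m G x (\<lambda>i. y i * s) = s * bform m G x y"
  by (simp_all add: bform_def sum_distrib_left mult_ac)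

lemma bform_uminus: 
  assumes "G \<in> carrier_mat m m"
  shows "bform m (- G) x y = - bform m G x y"
  using assms by (simp add: bform_def sum_negf)

lemma bform_sym:
  assumes "G \<in> carrier_mat m m" "G\<^sup>T = G"
  shows "bform m G x y = bform m G y x"
proof -
  have "G $$ (j, i) = G $$ (i, j)" if "i < m" "j < m" for i j
    using assms that by (metis carrier_matD index_transpose_mat(1))
  then show ?thesis
    unfolding bform_def by (subst sum.swap) (auto intro!: sum.cong simp: mult_ac)
qed

lemma bform_unitf_left:
  assumes "k < m"
  shows "bform m G (unitf k) y = (\<Sum>j<m. G $$ (k, j) * y j)"
proof -
  have "bform m G (unitf k) y = (\<Sum>i<m. if i = k then \<Sum>j<m. G $$ (k, j) * y j else 0)"
    unfolding bform_def by (intro sum.cong) (auto simp: unitf_def)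
  with assms show ?thesis by simp
qed

lemma bform_unitf_unitf:
  assumes "k < m" "l < m"
  shows "bform m G (unitf k) (unitf l) = G $$ (k, l)"
  using assms by (simp add: bform_unitf_left unitf_def if_distrib cong: if_cong)

lemma bform_expand:
  "bform m G x y = (\<Sum>i<m. x i * bform m G (unitf i) y)"
  unfolding bform_def[of m G x y]
  by (intro sum.cong) (auto simp: bform_unitf_left sum_distrib_left mult_ac)

lemma transpose_mult_bform:
  assumes "G \<in> carrier_mat m m" "M \<in> carrier_mat m m" "i < m" "j < m"
  shows "(M\<^sup>T * G * M) $$ (i, j) = bform m G (\<lambda>k. M $$ (k, i)) (\<lambda>k. M $$ (k, j))"
proof -
  have "(M\<^sup>T * G * M) $$ (i, j) = (\<Sum>k<m. M $$ (k, i) * (\<Sum>l<m. G $$ (k, l) * M $$ (l, j)))"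
    using assms by (simp add: scalar_prod_def atLeast0LessThan)
  then show ?thesis
    by (simp add: bform_def sum_distrib_left mult.assoc)
qed

lemma scalar_prod_mult_mat_vec:
  assumes "A \<in> carrier_mat n n" "v \<in> carrier_vec n"
  shows "v \<bullet> (A *\<^sub>v v) = bform n A (($) v) (($) v)"
  using assms by (simp add: scalar_prod_def bform_def atLeast0LessThan sum_distrib_left mult.assoc)

text \<open>The hypothesis on \<open>M\<close> is the claim for pairs of columns; the product of
  \<open>M\<close> with \<open>x\<close> is a combination of the columns, and bilinearity does the
  rest.\<close>

lemma bform_mult_mat_vec:
  assumes G: "G \<in> carrier_mat m m" and M: "M \<in> carrier_mat m m"
    and MG: "M\<^sup>T * G * M = c \<cdot>\<^sub>m G" and x: "x \<in> carrier_vec m" and y: "y \<in> carrier_vec m"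
  shows "bform m G (($) (M *\<^sub>v x)) (($) (M *\<^sub>v y)) = c * bform m G (($) x) (($) y)"
proof -
  have 1: "bform m G (\<lambda>k. M $$ (k, i)) (\<lambda>k. M $$ (k, j)) = c * G $$ (i, j)" if "i < m" "j < m" for i j
    using transpose_mult_bform[OF G M that] MG G that by simp
  have lin1: "bform m G (\<lambda>k. \<Sum>i\<in>A. f i k) z = (\<Sum>i\<in>A. bform m G (f i) z)" if "finite A" for f z and A :: "nat set"
    using that by induction (simp_all add: bform_linear)
  have lin2: "bform m G z (\<lambda>k. \<Sum>i\<in>A. f i k) = (\<Sum>i\<in>A. bform m G z (f i))" if "finite A" for f z and A :: "nat set"
    using that by induction (simp_all add: bform_linear)
  have e: "(M *\<^sub>v z) $ k = (\<Sum>i<m. z $ i * M $$ (k, i))" if "z \<in> carrier_vec m" "k < m" for z k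
    using that M by (simp add: scalar_prod_def atLeast0LessThan mult.commute)
  have "bform m G (($) (M *\<^sub>v x)) (($) (M *\<^sub>v y)) =
      bform m G (\<lambda>k. \<Sum>i<m. x $ i * M $$ (k, i)) (\<lambda>k. \<Sum>i<m. y $ i * M $$ (k, i))"
    using e x y by (intro bform_cong) auto
  also have "\<dots> = (\<Sum>i<m. \<Sum>j<m. x $ i * (y $ j * bform m G (\<lambda>k. M $$ (k, i)) (\<lambda>k. M $$ (k, j))))"
    by (simp add: lin1 lin2 bform_scale sum_distrib_left) 
  also have "\<dots> = (\<Sum>i<m. \<Sum>j<m. x $ i * (y $ j * (c * G $$ (i, j))))"
    using 1 by (intro sum.cong) auto
  also have "\<dots> = c * bform m G (($) x) (($) y)"
    by (simp add: bform_def sum_distrib_left mult_ac)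
  finally show ?thesis .
qed

text \<open>By symmetry the off-diagonal terms come in equal pairs, so modulo 2 only the diagonal
  matters. The induction splits off the last row and column together.\<close>

lemma even_bform:
  fixes G :: "int mat"
  assumes "\<And>i j. i < m \<Longrightarrow> j < m \<Longrightarrow> G $$ (i, j) = G $$ (j, i)"
    and "\<And>i. i < m \<Longrightarrow> even (G $$ (i, i))"
  shows "even (bform m G x x)"
  using assms
proof (induction m)
  case 0
  then show ?case by (simp add: bform_def)
next
  case (Suc m)
  have "bform (Suc m) G x x = bform m G x x + (\<Sum>i<m. x i * G $$ (i, m) * x m)
      + ((\<Sum>j<m. x m * G $$ (m, j) * x j) + x m * G $$ (m, m) * x m)"
    by (simp add: bform_def sum.distrib)
  also have "(\<Sum>j<m. x m * G $$ (m, j) * x j) = (\<Sum>i<m. x i * G $$ (i, m) * x m)"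
    using Suc.prems(1) by (intro sum.cong) (auto simp: mult_ac)
  finally show ?case using Suc by auto
qed

section \<open>Eichler transvections\<close>

text \<open>The parameter \<open>c\<close> stands for half of \<open>bform m G a a\<close>; it is kept separate since \<open>2\<close> need not be invertible.\<close>

definition eichler :: "nat \<Rightarrow> 'a::comm_ring_1 mat \<Rightarrow> (nat \<Rightarrow> 'a) \<Rightarrow> (nat \<Rightarrow> 'a) \<Rightarrow> 'a \<Rightarrow> 'a mat" where
  "eichler m G e a c = mat m m (\<lambda>(i, j). unitf j i - e i * bform m G a (unitf j)
     + a i * bform m G e (unitf j) - c * e i * bform m G e (unitf j))"

lemma eichler_carrier [simp]: "eichler m G e a c \<in> carrier_mat m m"
  by (simp add: eichler_def)

lemma eichler_dim [simp]: "dim_row (eichler m G e a c) = m" "dim_col (eichler m G e a c) = m"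
  by (simp_all add: eichler_def)

lemma bform_expand_right: "bform m G y x = (\<Sum>j<m. bform m G y (unitf j) * x j)"
proof -
  have "bform m G y (unitf j) = (\<Sum>i<m. y i * G $$ (i, j))" if "j < m" for j
    using that by (simp add: bform_def unitf_def if_distrib cong: if_cong)
  then have "(\<Sum>j<m. bform m G y (unitf j) * x j) = (\<Sum>j<m. (\<Sum>i<m. y i * G $$ (i, j)) * x j)"
    by (intro sum.cong) auto
  also have "\<dots> = bform m G y x"
    unfolding bform_def by (subst sum.swap) (simp add: sum_distrib_right)
  finally show ?thesis ..
qed

lemma eichler_sum:
  assumes "i < m"
  shows "(\<Sum>j<m. eichler m G e a c $$ (i, j) * x j) =
    x i - e i * bform m G a x + a i * bform m G e x - c * e i * bform m G e x"
proof -
  have "(\<Sum>j<m. eichler m G e a c $$ (i, j) * x j) =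
     (\<Sum>j<m. (if j = i then x i else 0) - e i * (bform m G a (unitf j) * x j)
        + a i * (bform m G e (unitf j) * x j) - c * e i * (bform m G e (unitf j) * x j))"
    using assms by (intro sum.cong) (auto simp: eichler_def unitf_def algebra_simps)
  also have "\<dots> = x i - e i * bform m G a x + a i * bform m G e x - c * e i * bform m G e x"
    using assms by (simp add: sum.distrib sum_subtractf sum_distrib_left[symmetric]
        bform_expand_right[symmetric])
  finally show ?thesis .
qed

lemma eichler_mult_vec:
  assumes "x \<in> carrier_vec m" "i < m"
  shows "(eichler m G e a c *\<^sub>v x) $ i = x $ i - e i * bform m G a (($) x)
    + a i * bform m G e (($) x) - c * e i * bform m G e (($) x)"
  using assms eichler_sum[of i m G e a c "($) x"]
  by (simp add: scalar_prod_def atLeast0LessThan)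

text \<open>The columns are the images of the unit vectors. In the product of columns
  \<open>i\<close> and \<open>j\<close> the mixed terms in \<open>a\<close> and \<open>e\<close>
  cancel in pairs, and the product of the pairings of \<open>e\<close> with the two unit vectors has
  the coefficient \<open>bform m G a a - 2 * c\<close>, which is 0.\<close>

lemma eichler_preserves:
  assumes G: "G \<in> carrier_mat m m" "G\<^sup>T = G"
    and ee: "bform m G e e = 0" and ea: "bform m G e a = 0" and aa: "bform m G a a = 2 * c"
  shows "(eichler m G e a c)\<^sup>T * G * eichler m G e a c = G"
proof (rule eq_matI)
  fix i j assume "i < dim_row G" "j < dim_col G"
  then have ij: "i < m" "j < m" using G by auto
  let ?E = "eichler m G e a c"
  note s = bform_sym[OF G]
  have ae: "bform m G a e = 0" using ea s by metis
  have col: "?E $$ (k, l) = unitf l k - e k * bform m G a (unitf l)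
     + a k * bform m G e (unitf l) - c * e k * bform m G e (unitf l)" if "k < m" "l < m" for k l
    using that by (simp add: eichler_def)
  have "(?E\<^sup>T * G * ?E) $$ (i, j) = bform m G (\<lambda>k. ?E $$ (k, i)) (\<lambda>k. ?E $$ (k, j))"
    using transpose_mult_bform[OF G(1) _ ij] by simp
  also have "\<dots> = bform m G
     (\<lambda>k. unitf i k - e k * bform m G a (unitf i)
     + a k * bform m G e (unitf i) - c * (e k * bform m G e (unitf i)))
     (\<lambda>k. unitf j k - e k * bform m G a (unitf j)
     + a k * bform m G e (unitf j) - c * (e k * bform m G e (unitf j)))"
    using col ij by (intro bform_cong) (auto simp: mult.assoc)
  also have "\<dots> = bform m G (unitf i) (unitf j)"
    apply (simp only: bform_linear bform_scale ee ea ae aa s[of "unitf i" e] s[of "unitf i" a])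
    apply (simp add: algebra_simps)
    done
  also have "\<dots> = G $$ (i, j)" using ij by (rule bform_unitf_unitf)
  finally show "(?E\<^sup>T * G * ?E) $$ (i, j) = G $$ (i, j)" .
qed (use G in auto)

text \<open>Over the reals every transvection is therefore a square, which forces its determinant to be \<open>1\<close>.\<close>

lemma eichler_square:
  assumes G: "G \<in> carrier_mat m m" "G\<^sup>T = G"
    and ee: "bform m G e e = 0" and ea: "bform m G e a = 0" and aa: "bform m G a a = 2 * c"
  shows "eichler m G e a c * eichler m G e a c = eichler m G e (\<lambda>i. 2 * a i) (4 * c)"
proof (rule eq_matI)
  fix i j assume "i < dim_row (eichler m G e (\<lambda>i. 2 * a i) (4 * c))"
    "j < dim_col (eichler m G e (\<lambda>i. 2 * a i) (4 * c))"
  then have ij: "i < m" "j < m" by auto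
  let ?E = "eichler m G e a c"
  note s = bform_sym[OF G]
  have ae: "bform m G a e = 0" using ea s by metis
  define x where "x = (\<lambda>k. unitf j k - e k * bform m G a (unitf j)
     + a k * bform m G e (unitf j) - c * (e k * bform m G e (unitf j)))"
  have "(?E * ?E) $$ (i, j) = (\<Sum>k<m. ?E $$ (i, k) * ?E $$ (k, j))"
    using ij by (simp add: scalar_prod_def atLeast0LessThan)
  also have "\<dots> = (\<Sum>k<m. ?E $$ (i, k) * x k)"
    using ij by (intro sum.cong) (auto simp: x_def eichler_def mult.assoc)
  also have "\<dots> = x i - e i * bform m G a x + a i * bform m G e x - c * e i * bform m G e x"
    using ij by (simp add: eichler_sum)
  also have "bform m G e x = bform m G e (unitf j)"
    by (simp only: x_def bform_linear bform_scale ee ea) simp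
  also have "bform m G a x = bform m G a (unitf j) + 2 * c * bform m G e (unitf j)"
    by (simp only: x_def bform_linear bform_scale aa ae) simp
  finally show "(?E * ?E) $$ (i, j) = eichler m G e (\<lambda>i. 2 * a i) (4 * c) $$ (i, j)"
    using ij by (simp add: x_def eichler_def algebra_simps bform_scale)
qed auto

text \<open>Every pairing with a unit vector is an entry of a row vector times \<open>G\<close>, so
  the difference to the identity has \<open>G\<close> as a right factor. This is the congruence that
  defines the discriminant kernel.\<close>

lemma eichler_eq_one_plus:
  assumes G: "G \<in> carrier_mat m m"
  shows "eichler m G e a c = 1\<^sub>m m + mat m m (\<lambda>(i, j). a i * e j - e i * a j - c * e i * e j) * G"
proof (rule eq_matI, goal_cases)
  case (1 i j)
  then have ij: "i < m" "j < m" using G by auto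
  have b: "bform m G y (unitf j) = (\<Sum>k<m. y k * G $$ (k, j))" for y
    using ij by (simp add: bform_def unitf_def if_distrib cong: if_cong)
  have "(1\<^sub>m m + mat m m (\<lambda>(i, j). a i * e j - e i * a j - c * e i * e j) * G) $$ (i, j) =
     unitf j i + (\<Sum>k<m. (a i * e k - e i * a k - c * e i * e k) * G $$ (k, j))"
    using ij G by (simp add: scalar_prod_def atLeast0LessThan unitf_def)
  also have "\<dots> = eichler m G e a c $$ (i, j)"
    using ij by (simp add: eichler_def b algebra_simps sum.distrib sum_subtractf sum_distrib_left)
  finally show ?case ..
qed (use G in auto)

lemma of_int_bform:
  assumes "G \<in> carrier_mat m m"
  shows "of_int (bform m G x y) = bform m (map_mat of_int G) (\<lambda>i. of_int (x i)) (\<lambda>i. of_int (y i))"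
  using assms by (simp add: bform_def)

lemma of_int_unitf: "of_int (unitf k i) = unitf k i"
  by (simp add: unitf_def)

lemma of_int_eichler:
  assumes "G \<in> carrier_mat m m"
  shows "map_mat of_int (eichler m G e a c) =
    eichler m (map_mat of_int G) (\<lambda>i. of_int (e i)) (\<lambda>i. of_int (a i)) (of_int c)"
  using assms by (intro eq_matI) (auto simp: eichler_def of_int_bform of_int_unitf)

section \<open>Paths in the orthogonal group\<close>

text \<open>The topology is pulled back along the entry map, so entrywise continuity is continuity
  of \<open>f\<close>. The image of the unit interval is then a connected set joining
  \<open>f 0\<close>, which may be any point of the component, to \<open>f 1\<close>.\<close>

lemma SO_plus_path:
  assumes "f 0 \<in> SO_plus m A"
    and SO: "\<And>t. t \<in> {0..1::real} \<Longrightarrow> f t \<in> SO_real m A"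
    and cont: "\<And>i j. i < m \<Longrightarrow> j < m \<Longrightarrow> continuous_on {0..1} (\<lambda>t. f t $$ (i, j))"
  shows "f 1 \<in> SO_plus m A"
proof -
  let ?X = "subtopology (mat_topology m) (SO_real m A)"
  have "continuous_map (top_of_set {0..1}) (mat_topology m) f"
    unfolding mat_topology_def
  proof (rule continuous_map_pullback')
    show "continuous_map (top_of_set {0..1})
       (product_topology (\<lambda>_. euclideanreal) ({..<m} \<times> {..<m}))
       ((\<lambda>M. restrict (\<lambda>p. M $$ p) ({..<m} \<times> {..<m})) \<circ> f)"
      unfolding continuous_map_componentwise using cont by auto
    show "topspace (top_of_set {0..1}) \<subseteq> f -` carrier_mat m m"
      using SO by (auto simp: SO_real_def)
  qed
  then have c: "continuous_map (top_of_set {0..1}) ?X f"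
    using SO by (auto simp: continuous_map_in_subtopology)
  have "connectedin (top_of_set {0..1::real}) {0..1}"
    by (simp add: connectedin_subtopology)
  then have "connectedin ?X (f ` {0..1})"
    using c connectedin_continuous_map_image by blast
  then have "connected_component_of ?X (f 0) (f 1)"
    unfolding connected_component_of_def by (intro exI[of _ "f ` {0..1}"]) auto
  moreover have "connected_component_of ?X (1\<^sub>m m) (f 0)"
    using assms(1) by (simp add: SO_plus_def)
  ultimately show ?thesis
    unfolding SO_plus_def using connected_component_of_trans by fastforce
qed

lemma SO_plus_subset: "SO_plus m A \<subseteq> SO_real m A"
  unfolding SO_plus_def using connected_component_of_subset_topspace[of "subtopology (mat_topology m) (SO_real m A)"]
  by fastforce

lemma one_in_SO_plus:
  assumes "A \<in> carrier_mat m m"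
  shows "1\<^sub>m m \<in> SO_plus m A"
proof -
  have "1\<^sub>m m \<in> topspace (subtopology (mat_topology m) (SO_real m A))"
    using assms by (auto simp: SO_real_def mat_topology_def topspace_pullback_topology PiE_def)
  then show ?thesis by (simp add: SO_plus_def connected_component_of_refl)
qed

lemma SO_real_mult:
  assumes "M \<in> SO_real m A" "N \<in> SO_real m A" "A \<in> carrier_mat m m"
  shows "M * N \<in> SO_real m A"
proof -
  have M: "M \<in> carrier_mat m m" and N: "N \<in> carrier_mat m m"
    using assms by (auto simp: SO_real_def)
  have "(M * N)\<^sup>T * A * (M * N) = N\<^sup>T * (M\<^sup>T * A * M) * N"
  proof -
    have "(M * N)\<^sup>T * A * (M * N) = N\<^sup>T * M\<^sup>T * A * (M * N)"
      using M N by (simp only: transpose_mult)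
    also have "\<dots> = N\<^sup>T * M\<^sup>T * A * M * N"
      using M N assms(3) by (intro assoc_mult_mat[symmetric, of _ m m _ m]) auto
    also have "N\<^sup>T * M\<^sup>T * A = N\<^sup>T * (M\<^sup>T * A)"
      using M N assms(3) by (intro assoc_mult_mat[of _ m m _ m]) auto
    also have "N\<^sup>T * (M\<^sup>T * A) * M = N\<^sup>T * (M\<^sup>T * A * M)"
      using M N assms(3) by (intro assoc_mult_mat[of _ m m _ m]) auto
    finally show ?thesis .
  qed
  moreover have "Determinant.det (M * N) = 1"
    using assms M N det_mult[OF M N] by (simp add: SO_real_def)
  ultimately show ?thesis
    using assms M N by (simp add: SO_real_def)
qed

section \<open>Congruences and block matrices\<close>

lemma simultaneous_congruences:
  fixes A :: "nat \<Rightarrow> int"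
  assumes "finite P" "\<And>p. p \<in> P \<Longrightarrow> prime p"
  shows "\<exists>x. \<forall>p\<in>P. [x = A p] (mod int p)"
proof -
  \<comment> \<open>The system is solved over the natural numbers, with each target replaced by its
    nonnegative residue.\<close>
  have "\<exists>x. \<forall>p\<in>P. [x = nat (A p mod int p)] (mod p)"
    using assms by (intro chinese_remainder_nat ballI impI) (auto simp: primes_coprime)
  then obtain x where x: "[x = nat (A p mod int p)] (mod p)" if "p \<in> P" for p by blast
  have "[int x = A p] (mod int p)" if "p \<in> P" for p
  proof -
    have "int p > 0" using assms(2)[OF that] prime_gt_0_nat by simp
    then have "int (nat (A p mod int p)) = A p mod int p" by simp
    then show ?thesis using x[OF that] by (metis cong_int_iff cong_mod_left cong_sym cong_trans cong_refl)
  qed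
  then show ?thesis by blast
qed

lemma block_upperI:
  assumes P: "P \<in> carrier_mat (k + 2) (k + 2)"
    and col: "\<And>i. i < k + 2 \<Longrightarrow> P $$ (i, 0) = \<alpha> * unitf 0 i"
    and row: "\<And>j. j < k + 2 \<Longrightarrow> P $$ (k + 1, j) = \<delta> * unitf (k + 1) j"
  shows "block_upper k \<alpha> \<delta> P"
  unfolding block_upper_def
proof (intro bexI)
  show "P = four_block_mat (scalar_block \<alpha>) (mat 1 (k + 1) (\<lambda>(i, j). P $$ (0, j + 1)))
      (0\<^sub>m (k + 1) 1) (four_block_mat (mat k k (\<lambda>(i, j). P $$ (i + 1, j + 1)))
        (mat k 1 (\<lambda>(i, j). P $$ (i + 1, k + 1))) (0\<^sub>m 1 k) (scalar_block \<delta>))"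
    (is "P = ?Q")
  proof (rule eq_matI)
    fix i j assume "i < dim_row ?Q" "j < dim_col ?Q"
    then have ij: "i < k + 2" "j < k + 2" by auto
    consider "i = 0" | "0 < i" "j = 0" | "i = k + 1" "0 < j" | "0 < i" "i < k + 1" "0 < j"
      using ij by linarith
    then show "P $$ (i, j) = ?Q $$ (i, j)"
    proof cases
      case 1
      then show ?thesis using ij col[of 0] by (cases "j = 0") (auto simp: unitf_def)
    next
      case 2
      then show ?thesis using ij col[of i] by (auto simp: unitf_def)
    next
      case 3
      then show ?thesis using ij row[of j] by (auto simp: unitf_def)
    next
      case 4
      then have "j = k + 1 \<or> j - 1 < k" using ij by auto
      with 4 ij show ?thesis by auto
    qed
  qed (use P in auto)
qed auto

lemma eq_diag_block_mat:
  assumes P: "P \<in> carrier_mat (k + 2) (k + 2)"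
    and col: "\<And>i. i < k + 2 \<Longrightarrow> P $$ (i, 0) = \<alpha> * unitf 0 i" "\<And>i. i < k + 2 \<Longrightarrow> P $$ (i, k + 1) = \<delta> * unitf (k + 1) i"
    and row: "\<And>j. j < k + 2 \<Longrightarrow> P $$ (0, j) = \<alpha> * unitf 0 j" "\<And>j. j < k + 2 \<Longrightarrow> P $$ (k + 1, j) = \<delta> * unitf (k + 1) j"
  shows "P = diag_block_mat [scalar_block \<alpha>, mat k k (\<lambda>(i, j). P $$ (i + 1, j + 1)), scalar_block \<delta>]"
    (is "P = ?Q")
proof (rule eq_matI)
  fix i j assume "i < dim_row ?Q" "j < dim_col ?Q"
  then have ij: "i < k + 2" "j < k + 2" by (auto simp: Let_def)
  consider "i = 0" | "i = k + 1" | "0 < i" "i < k + 1" "j = 0" | "0 < i" "i < k + 1" "j = k + 1"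
    | "0 < i" "i < k + 1" "0 < j" "j < k + 1"
    using ij by linarith
  then show "P $$ (i, j) = ?Q $$ (i, j)"
  proof cases
    case 1
    with ij row(1) show ?thesis by (auto simp: Let_def unitf_def)
  next
    case 2
    with ij row(2) show ?thesis by (auto simp: Let_def unitf_def)
  next
    case 3
    with ij col(1) show ?thesis by (auto simp: Let_def unitf_def)
  next
    case 4
    with ij col(2) show ?thesis by (auto simp: Let_def unitf_def)
  next
    case 5
    with ij show ?thesis by (auto simp: Let_def)
  qed
qed (use P in \<open>auto simp: Let_def\<close>)

section \<open>The quadratic lattice of \<open>S\<^sub>1\<close>\<close>

lemma hyp_ext_carrier: "hyp_ext k A \<in> carrier_mat (k + 2) (k + 2)"
  by (simp add: hyp_ext_def)

text \<open>\<open>hyp_ext\<close> adds a hyperbolic plane, spanned by the two outer coordinates, as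
  an orthogonal summand. Doing this twice makes \<open>0\<close>, \<open>n + 3\<close> and
  \<open>1\<close>, \<open>n + 2\<close> the hyperbolic pairs of the form of
  \<open>S1_mat\<close>.\<close>

lemma bform_hyp_ext:
  "bform (k + 2) (hyp_ext k A) x y =
     x 0 * y (k + 1) + x (k + 1) * y 0 + bform k A (\<lambda>i. x (Suc i)) (\<lambda>i. y (Suc i))"
proof -
  have split: "(\<Sum>i<k+2. f i) = f 0 + (\<Sum>i<k. f (Suc i)) + f (k + 1)" for f :: "nat \<Rightarrow> int"
    using sum.lessThan_Suc_shift[of f "Suc k"] by simp
  have "(\<Sum>i<k. \<Sum>j<k. x (Suc i) * hyp_ext k A $$ (Suc i, Suc j) * y (Suc j)) =
      bform k A (\<lambda>i. x (Suc i)) (\<lambda>i. y (Suc i))"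
    unfolding bform_def by (intro sum.cong) (auto simp: hyp_ext_def)
  then show ?thesis
    unfolding bform_def[of "k + 2"] split by (simp add: hyp_ext_def sum.distrib)
qed

lemma hyp_ext_sym:
  assumes "A \<in> carrier_mat k k" "A\<^sup>T = A"
  shows "(hyp_ext k A)\<^sup>T = hyp_ext k A"
proof -
  have "A $$ (j, i) = A $$ (i, j)" if "i < k" "j < k" for i j
    using assms that by (metis carrier_matD index_transpose_mat(1))
  then show ?thesis by (intro eq_matI) (auto simp: hyp_ext_def)
qed

text \<open>Take determinants of the relation and cancel that of \<open>G\<close>. With
  \<open>c = 1\<close> this bounds the determinant of an isometry; with \<open>c = r\<close> it
  shows that the determinant of a similitude involves only primes dividing \<open>r\<close>.\<close>

lemma similitude_det_square:
  fixes G :: "'a::idom mat"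
  assumes G: "G \<in> carrier_mat m m" and E: "E \<in> carrier_mat m m"
    and EG: "E\<^sup>T * G * E = c \<cdot>\<^sub>m G" and "Determinant.det G \<noteq> 0"
  shows "Determinant.det E ^ 2 = c ^ m"
proof -
  have "Determinant.det (E\<^sup>T * G * E) = Determinant.det (E\<^sup>T * G) * Determinant.det E"
    using G E by (intro det_mult) auto
  also have "Determinant.det (E\<^sup>T * G) = Determinant.det E * Determinant.det G"
    using G E det_mult[of "E\<^sup>T" m G] det_transpose[OF E] by simp
  finally have "c ^ m = Determinant.det E * Determinant.det E"
    using G assms(4) by (simp add: EG det_smult mult_ac)
  then show ?thesis by (simp only: power2_eq_square)
qed

text \<open>The adjugate is an integral inverse up to the determinant, so a common divisor of the
  entries of \<open>A\<close> times \<open>v\<close> divides \<open>det A\<close> times each entry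
  of \<open>v\<close>.\<close>

lemma adj_mat_mult_vec:
  assumes A: "A \<in> carrier_mat m m" and v: "v \<in> carrier_vec m" and i: "i < m"
  shows "(adj_mat A *\<^sub>v (A *\<^sub>v v)) $ i = Determinant.det A * v $ i"
proof -
  have "adj_mat A *\<^sub>v (A *\<^sub>v v) = (adj_mat A * A) *\<^sub>v v"
    using adj_mat[OF A] A v by (intro assoc_mult_mat_vec[symmetric]) auto
  also have "\<dots> $ i = (\<Sum>k<m. Determinant.det A * (if i = k then 1 else 0) * v $ k)"
    unfolding adj_mat(3)[OF A]
    using i v by (simp add: scalar_prod_def atLeast0LessThan del: sum.delta sum.delta') (rule sum.cong, auto)
  also have "\<dots> = (\<Sum>k<m. if k = i then Determinant.det A * v $ k else 0)"
    by (intro sum.cong) auto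
  finally show ?thesis using i by simp
qed

text \<open>A product of Eichler transvections is joined to the identity by scaling the vectors \<open>a\<close>,
  so this group lies in \<open>SO_plus\<close> without knowing that \<open>SO_plus\<close> itself is a group.\<close>

inductive_set eichler_group :: "nat \<Rightarrow> int mat \<Rightarrow> int mat set" for n S where
  one: "1\<^sub>m (n + 4) \<in> eichler_group n S"
| step: "M \<in> eichler_group n S \<Longrightarrow> bform (n + 4) (S1_mat n S) e e = 0 \<Longrightarrow>
    bform (n + 4) (S1_mat n S) e a = 0 \<Longrightarrow> bform (n + 4) (S1_mat n S) a a = 2 * c \<Longrightarrow>
    eichler (n + 4) (S1_mat n S) e a c * M \<in> eichler_group n S"

lemma eichler_group_carrier: "M \<in> eichler_group n S \<Longrightarrow> M \<in> carrier_mat (n + 4) (n + 4)"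
  by (induction rule: eichler_group.induct) auto

lemma eichler_group_mult:
  assumes "M \<in> eichler_group n S" "N \<in> eichler_group n S"
  shows "M * N \<in> eichler_group n S"
  using assms
proof (induction rule: eichler_group.induct)
  case one
  then show ?case using eichler_group_carrier[OF one] by simp
next
  case (step M e a c)
  then have "eichler (n + 4) (S1_mat n S) e a c * (M * N) \<in> eichler_group n S"
    by (intro eichler_group.step) auto
  then show ?case
    using eichler_group_carrier[OF step(1)] eichler_group_carrier[OF step(6)]
    by (subst assoc_mult_mat[OF eichler_carrier]) auto
qed

locale even_lattice =
  fixes n :: nat and S :: "int mat"
  assumes S_carrier [simp]: "S \<in> carrier_mat n n"
    and S_sym: "S\<^sup>T = S"
    and S_even: "\<And>i. i < n \<Longrightarrow> even (S $$ (i, i))"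
    and S_pos_def: "pos_def_mat n S"
begin

abbreviation "G \<equiv> S1_mat n S"
abbreviation "B \<equiv> bform (n + 4) G"

lemma S_dim [simp]: "dim_row S = n" "dim_col S = n"
  using S_carrier by (blast dest: carrier_matD)+

lemma G_carrier [simp]: "G \<in> carrier_mat (n + 4) (n + 4)"
  unfolding S1_mat_def using hyp_ext_carrier[of "n + 2"] by (simp add: numeral_eq_Suc)

lemma G_dim [simp]: "dim_row G = n + 4" "dim_col G = n + 4"
  using G_carrier by (blast dest: carrier_matD)+

lemma G_sym: "G\<^sup>T = G"
  unfolding S1_mat_def S0_mat_def
  by (intro hyp_ext_sym hyp_ext_carrier) (auto simp: S_sym transpose_uminus)

lemma B_eq: "B x y = x 0 * y (n + 3) + x (n + 3) * y 0 + x 1 * y (n + 2) + x (n + 2) * y 1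
    - bform n S (\<lambda>i. x (i + 2)) (\<lambda>i. y (i + 2))"
  using bform_hyp_ext[of "n + 2" "S0_mat n S" x y]
    bform_hyp_ext[of n "- S" "\<lambda>i. x (Suc i)" "\<lambda>i. y (Suc i)"]
  by (simp add: S1_mat_def S0_mat_def bform_uminus eval_nat_numeral)

lemma B_sym: "B x y = B y x"
  by (rule bform_sym[OF G_carrier G_sym])

lemma S_entry_sym: "i < n \<Longrightarrow> j < n \<Longrightarrow> S $$ (i, j) = S $$ (j, i)"
  using S_sym by (metis S_carrier carrier_matD index_transpose_mat(1))

lemma B_even: "even (B x x)"
proof -
  have "even (bform n S y y)" for y
    using S_entry_sym S_even by (intro even_bform) auto
  then show ?thesis by (simp add: B_eq)
qed

text \<open>Pairing with one vector of a hyperbolic pair reads off the coordinate at its partner.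
  Thus a divisor of all pairings with \<open>y\<close> divides the four outer coordinates, and only
  the middle part needs an argument about \<open>S\<close>.\<close>

lemma B_unitf:
  "B (unitf 0) y = y (n + 3)" "B (unitf (Suc 0)) y = y (n + 2)"
  "B (unitf (n + 2)) y = y 1" "B (unitf (n + 3)) y = y 0"
  "j < n \<Longrightarrow> B (unitf (j + 2)) y = - (\<Sum>k<n. S $$ (j, k) * y (k + 2))"
proof -
  have "bform n S (\<lambda>i. unitf (j + 2) (i + 2)) (\<lambda>i. y (i + 2)) = (\<Sum>k<n. S $$ (j, k) * y (k + 2))"
    if "j < n"
    using that bform_unitf_left[of j n S "\<lambda>i. y (i + 2)"] by (simp add: unitf_def[abs_def])
  moreover have "bform n S (\<lambda>i. unitf (n + 2) (i + 2)) (\<lambda>i. y (i + 2)) = bform n S (\<lambda>i. 0) (\<lambda>i. y (i + 2))"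
    "bform n S (\<lambda>i. unitf (n + 3) (i + 2)) (\<lambda>i. y (i + 2)) = bform n S (\<lambda>i. 0) (\<lambda>i. y (i + 2))"
    by (intro bform_cong; simp add: unitf_def)+
  ultimately show
    "B (unitf 0) y = y (n + 3)" "B (unitf (Suc 0)) y = y (n + 2)"
    "B (unitf (n + 2)) y = y 1" "B (unitf (n + 3)) y = y 0"
    "j < n \<Longrightarrow> B (unitf (j + 2)) y = - (\<Sum>k<n. S $$ (j, k) * y (k + 2))"
    unfolding B_eq by (simp_all add: unitf_def)
qed

lemma S_nondegenerate:
  assumes "y \<in> carrier_vec n" "S *\<^sub>v y = 0\<^sub>v n"
  shows "y = 0\<^sub>v n"
proof (rule ccontr)
  assume "y \<noteq> 0\<^sub>v n"
  let ?x = "map_vec real_of_int y"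
  have x: "?x \<in> carrier_vec n" "?x \<noteq> 0\<^sub>v n"
    using assms(1) \<open>y \<noteq> 0\<^sub>v n\<close> by (auto simp: vec_eq_iff)
  have "real_mat S *\<^sub>v ?x = map_vec real_of_int (S *\<^sub>v y)"
    using of_int_hom.mult_mat_vec_hom[OF S_carrier assms(1), where 'a = real] by simp
  then have "real_mat S *\<^sub>v ?x = 0\<^sub>v n" using assms(2) by auto
  moreover have "?x \<bullet> (real_mat S *\<^sub>v ?x) > 0"
    using x S_pos_def unfolding pos_def_mat_def by blast
  ultimately show False using x(1) by (metis less_irrefl scalar_prod_right_zero)
qed

lemma det_S_nonzero: "Determinant.det S \<noteq> 0"
  using S_nondegenerate det_0_iff_vec_prod_zero[OF S_carrier] by blast

lemma G_mult_vec:
  assumes "y \<in> carrier_vec (n + 4)" "i < n + 4"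
  shows "(G *\<^sub>v y) $ i = B (unitf i) (($) y)"
  using assms by (simp add: bform_unitf_left scalar_prod_def atLeast0LessThan)

lemma index_cases:
  assumes "i < n + 4"
  obtains "i = 0" | "i = 1" | j where "j < n" "i = j + 2" | "i = n + 2" | "i = n + 3"
proof -
  have "i = 0 \<or> i = 1 \<or> (i - 2 < n \<and> i = i - 2 + 2) \<or> i = n + 2 \<or> i = n + 3"
    using assms by linarith
  then show ?thesis using that by blast
qed

text \<open>A kernel vector pairs to 0 with all unit vectors: its outer coordinates vanish at once,
  and its middle part lies in the kernel of the nondegenerate \<open>S\<close>.\<close>

lemma det_G_nonzero: "Determinant.det G \<noteq> 0"
proof
  assume "Determinant.det G = 0"
  then obtain y where y: "y \<in> carrier_vec (n + 4)" "y \<noteq> 0\<^sub>v (n + 4)" "G *\<^sub>v y = 0\<^sub>v (n + 4)"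
    using det_0_iff_vec_prod_zero[OF G_carrier] by blast
  have B0: "B (unitf i) (($) y) = 0" if "i < n + 4" for i
    using G_mult_vec[OF y(1) that] y(3) that by simp
  have "S *\<^sub>v vec n (\<lambda>k. y $ (k + 2)) = 0\<^sub>v n"
  proof (rule eq_vecI)
    fix j assume "j < dim_vec (0\<^sub>v n)"
    then have j: "j < n" by simp
    show "(S *\<^sub>v vec n (\<lambda>k. y $ (k + 2))) $ j = 0\<^sub>v n $ j"
      using B0[of "j + 2"] j B_unitf(5)[OF j, of "($) y"]
      by (simp add: scalar_prod_def atLeast0LessThan)
  qed simp
  then have "vec n (\<lambda>k. y $ (k + 2)) = 0\<^sub>v n"
    by (rule S_nondegenerate[OF vec_carrier])
  then have mid: "y $ (j + 2) = 0" if "j < n" for j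
    using that by (metis index_vec index_zero_vec(1))
  have out: "y $ 0 = 0" "y $ 1 = 0" "y $ (n + 2) = 0" "y $ (n + 3) = 0"
    using B0[of "n + 3"] B0[of "n + 2"] B0[of "Suc 0"] B0[of 0]
    unfolding B_unitf by simp_all
  have "y $ i = 0" if "i < n + 4" for i
    by (rule index_cases[OF that]) (use mid out in auto)
  then have "y = 0\<^sub>v (n + 4)" using y(1) by (intro eq_vecI) auto
  with y(2) show False by simp
qed

section \<open>Transvections in the identity component and in the discriminant kernel\<close>

lemma eichler_real_SO:
  assumes ee: "B e e = 0" and ea: "B e a = 0" and aa: "B a a = 2 * c"
  shows "eichler (n + 4) (real_mat G) (\<lambda>i. of_int (e i)) (\<lambda>i. t * of_int (a i)) (t\<^sup>2 * of_int c)
      \<in> SO_real (n + 4) (real_mat G)"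
proof -
  let ?E = "\<lambda>t. eichler (n + 4) (real_mat G) (\<lambda>i. of_int (e i)) (\<lambda>i. t * of_int (a i)) (t\<^sup>2 * of_int c)"
  have G: "real_mat G \<in> carrier_mat (n + 4) (n + 4)" "(real_mat G)\<^sup>T = real_mat G"
    using G_sym by (simp_all add: map_mat_transpose)
  have ee': "bform (n + 4) (real_mat G) (\<lambda>i. of_int (e i)) (\<lambda>i. of_int (e i)) = 0"
    using of_int_bform[OF G_carrier, of e e, where 'a = real] ee by simp
  have ea': "bform (n + 4) (real_mat G) (\<lambda>i. of_int (e i)) (\<lambda>i. t * of_int (a i)) = 0" for t
    using of_int_bform[OF G_carrier, of e a, where 'a = real] ea by (simp add: bform_scale)
  \<comment> \<open>When \<open>a\<close> is scaled by \<open>t\<close>, the half norm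
    \<open>c\<close> scales by the square of \<open>t\<close>; only with this choice does the whole
    path consist of isometries.\<close>
  have aa': "bform (n + 4) (real_mat G) (\<lambda>i. t * of_int (a i)) (\<lambda>i. t * of_int (a i)) = 2 * (t\<^sup>2 * of_int c)" for t
    using of_int_bform[OF G_carrier, of a a, where 'a = real] aa
    by (simp add: bform_scale power2_eq_square)
  note pres = eichler_preserves[OF G ee' ea' aa']
  have "Determinant.det (real_mat G) \<noteq> 0"
    using det_G_nonzero by (simp add: of_int_hom.hom_det)
  moreover have "(?E t)\<^sup>T * real_mat G * ?E t = 1 \<cdot>\<^sub>m real_mat G" for t
    unfolding pres by auto
  ultimately have "Determinant.det (?E t) ^ 2 = 1 ^ (n + 4)" for t
    using similitude_det_square[OF G(1) eichler_carrier] by blast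
  then have det2: "Determinant.det (?E t) ^ 2 = 1" for t by simp
  have "?E (t / 2) * ?E (t / 2) = ?E t"
    using eichler_square[OF G ee' ea'[of "t / 2"] aa'[of "t / 2"]]
    by (simp add: power2_eq_square)
  then have "Determinant.det (?E t) = Determinant.det (?E (t / 2) * ?E (t / 2))"
    by (simp only:)
  also have "\<dots> = Determinant.det (?E (t / 2)) ^ 2"
    unfolding power2_eq_square by (rule det_mult[OF eichler_carrier eichler_carrier])
  also have "\<dots> = 1" by (rule det2)
  finally have "Determinant.det (?E t) = 1" .
  with pres[of t] show ?thesis by (simp add: SO_real_def)
qed

lemma eichler_group_SO_plus:
  assumes "M \<in> eichler_group n S"
  shows "real_mat M \<in> SO_plus (n + 4) (real_mat G)"
  using assms
proof (induction rule: eichler_group.induct)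
  case one
  have "real_mat (1\<^sub>m (n + 4)) = 1\<^sub>m (n + 4)" by (rule of_int_hom.mat_hom_one)
  then show ?case using one_in_SO_plus[of "real_mat G" "n + 4"] by simp
next
  case (step M e a c)
  have M: "M \<in> carrier_mat (n + 4) (n + 4)" using step(1) by (rule eichler_group_carrier)
  define E where "E = (\<lambda>t. eichler (n + 4) (real_mat G) (\<lambda>i. of_int (e i)) (\<lambda>i. t * of_int (a i)) (t\<^sup>2 * of_int c))"
  have E [simp]: "E t \<in> carrier_mat (n + 4) (n + 4)" for t by (simp add: E_def)
  \<comment> \<open>The path \<open>E t * real_mat M\<close> starts at \<open>real_mat M\<close>,
    which is in the component by induction, and ends at the new product.\<close>
  have "E 0 = 1\<^sub>m (n + 4)"
    by (rule eq_matI) (auto simp: E_def eichler_def unitf_def)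
  then have "E 0 * real_mat M \<in> SO_plus (n + 4) (real_mat G)"
    using step M by simp
  then have "E 1 * real_mat M \<in> SO_plus (n + 4) (real_mat G)"
  proof (rule SO_plus_path[of "\<lambda>t. E t * real_mat M"])
    show "E t * real_mat M \<in> SO_real (n + 4) (real_mat G)" for t
      using eichler_real_SO[OF step(2-4)] step.IH SO_plus_subset
      by (intro SO_real_mult) (auto simp: E_def)
    fix i j assume ij: "i < n + 4" "j < n + 4"
    have "(E t * real_mat M) $$ (i, j) = (\<Sum>k<n+4. E t $$ (i, k) * of_int (M $$ (k, j)))" for t
      using ij M by (simp add: scalar_prod_def atLeast0LessThan E_def)
    moreover have "continuous_on {0..1} (\<lambda>t. \<Sum>k<n+4. E t $$ (i, k) * of_int (M $$ (k, j)))"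
    proof (rule continuous_on_sum)
      fix k assume "k \<in> {..<n + 4}"
      then have "E t $$ (i, k) = unitf k i
           - of_int (e i) * (t * bform (n + 4) (real_mat G) (\<lambda>i. of_int (a i)) (unitf k))
           + t * of_int (a i) * bform (n + 4) (real_mat G) (\<lambda>i. of_int (e i)) (unitf k)
           - t\<^sup>2 * of_int c * of_int (e i) * bform (n + 4) (real_mat G) (\<lambda>i. of_int (e i)) (unitf k)" for t
        using ij by (simp add: E_def eichler_def bform_scale)
      then show "continuous_on {0..1} (\<lambda>t. E t $$ (i, k) * of_int (M $$ (k, j)))"
        by (simp only:) (intro continuous_intros)
    qed
    ultimately show "continuous_on {0..1} (\<lambda>t. (E t * real_mat M) $$ (i, j))" by simp
  qed
  moreover have "real_mat (eichler (n + 4) G e a c * M) = E 1 * real_mat M"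
    using of_int_hom.mat_hom_mult[OF eichler_carrier M, where 'a = real]
    by (simp add: of_int_eichler[OF G_carrier] E_def)
  ultimately show ?case by simp
qed

lemma eichler_group_subset: "eichler_group n S \<subseteq> Gamma_tilde n S"
proof
  fix M assume "M \<in> eichler_group n S"
  then have "\<exists>X\<in>carrier_mat (n + 4) (n + 4). M = 1\<^sub>m (n + 4) + X * G"
  proof (induction rule: eichler_group.induct)
    case one
    show ?case by (intro bexI[of _ "0\<^sub>m (n + 4) (n + 4)"]) (auto simp: left_mult_zero_mat[OF G_carrier])
  next
    case (step M e a c)
    then obtain X where X: "X \<in> carrier_mat (n + 4) (n + 4)" "M = 1\<^sub>m (n + 4) + X * G" by blast
    obtain Y where Y: "Y \<in> carrier_mat (n + 4) (n + 4)" "eichler (n + 4) G e a c = 1\<^sub>m (n + 4) + Y * G"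
      using eichler_eq_one_plus[OF G_carrier] mat_carrier by blast
    \<comment> \<open>The factors combine to \<open>1 + (Y + (X + Y * G * X)) * G\<close>, which
      supplies the witness.\<close>
    have "(1\<^sub>m (n + 4) + Y * G) * (1\<^sub>m (n + 4) + X * G) = (1\<^sub>m (n + 4) + Y * G) + (1\<^sub>m (n + 4) + Y * G) * (X * G)"
      using X(1) Y(1) by (subst mult_add_distrib_mat[of _ "n + 4" "n + 4" _ "n + 4"]) auto
    also have "(1\<^sub>m (n + 4) + Y * G) * (X * G) = X * G + Y * G * (X * G)"
      using X(1) Y(1) by (subst add_mult_distrib_mat[of _ "n + 4" "n + 4" _ _ "n + 4"]) auto
    also have "X * G + Y * G * (X * G) = (X + Y * G * X) * G"
    proof -
      have "Y * G * (X * G) = Y * G * X * G"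
        using X(1) Y(1) by (intro assoc_mult_mat[symmetric, of _ "n + 4" "n + 4" _ "n + 4"]) auto
      then show ?thesis
        using X(1) Y(1) by (subst add_mult_distrib_mat[of _ "n + 4" "n + 4" _ _ "n + 4"]) auto
    qed
    also have "1\<^sub>m (n + 4) + Y * G + (X + Y * G * X) * G = 1\<^sub>m (n + 4) + (Y * G + (X + Y * G * X) * G)"
      using X(1) Y(1) by (intro assoc_add_mat[of _ "n + 4" "n + 4"]) auto
    also have "Y * G + (X + Y * G * X) * G = (Y + (X + Y * G * X)) * G"
      using X(1) Y(1) by (subst add_mult_distrib_mat[of _ "n + 4" "n + 4" _ _ "n + 4"]) auto
    finally show ?case using X Y by (intro bexI[of _ "Y + (X + Y * G * X)"]) auto
  qed
  with \<open>M \<in> eichler_group n S\<close> show "M \<in> Gamma_tilde n S"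
    using eichler_group_SO_plus eichler_group_carrier by (simp add: Gamma_tilde_def Gamma_def)
qed

lemma eichler_group_preserves:
  assumes "M \<in> eichler_group n S"
  shows "M\<^sup>T * G * M = G"
proof -
  have M: "M \<in> carrier_mat (n + 4) (n + 4)" using assms by (rule eichler_group_carrier)
  have "real_mat M \<in> SO_real (n + 4) (real_mat G)"
    using eichler_group_SO_plus[OF assms] SO_plus_subset by blast
  then have "real_mat (M\<^sup>T * G * M) = real_mat G"
    using M of_int_hom.mat_hom_mult[of "M\<^sup>T * G" "n + 4" "n + 4" M "n + 4", where 'a = real]
      of_int_hom.mat_hom_mult[of "M\<^sup>T" "n + 4" "n + 4" G "n + 4", where 'a = real]
    by (simp add: SO_real_def map_mat_transpose)
  then show ?thesis by (rule of_int_hom.mat_hom_inj)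
qed

section \<open>The Eichler criterion\<close>

text \<open>The orbit relation of \<open>eichler_group\<close>, used as a preorder: reductions are
  chained by \<open>reach_trans\<close> and the accumulated product is never written out.\<close>

definition reach :: "int vec \<Rightarrow> int vec \<Rightarrow> bool" where
  "reach x y \<longleftrightarrow> x \<in> carrier_vec (n + 4) \<and> (\<exists>T\<in>eichler_group n S. y = T *\<^sub>v x)"

lemma reach_refl: "x \<in> carrier_vec (n + 4) \<Longrightarrow> reach x x"
  unfolding reach_def using eichler_group.one by (metis one_mult_mat_vec)

lemma reach_carrier: "reach x y \<Longrightarrow> x \<in> carrier_vec (n + 4) \<and> y \<in> carrier_vec (n + 4)"
  unfolding reach_def by (auto dest!: eichler_group_carrier)

lemma reach_trans:
  assumes "reach x y" "reach y z"
  shows "reach x z"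
proof -
  obtain T U where T: "T \<in> eichler_group n S" "y = T *\<^sub>v x" "x \<in> carrier_vec (n + 4)"
    and U: "U \<in> eichler_group n S" "z = U *\<^sub>v y"
    using assms by (auto simp: reach_def)
  have "z = (U * T) *\<^sub>v x"
    using T U eichler_group_carrier by (simp add: assoc_mult_mat_vec[of _ "n + 4" "n + 4" _ "n + 4"])
  with T(3) eichler_group_mult[OF U(1) T(1)] show ?thesis unfolding reach_def by blast
qed

lemma reach_bform:
  assumes "reach x y"
  shows "B (($) y) (($) y) = B (($) x) (($) x)"
proof -
  obtain T where T: "T \<in> eichler_group n S" "y = T *\<^sub>v x" "x \<in> carrier_vec (n + 4)"
    using assms by (auto simp: reach_def)
  have "T\<^sup>T * G * T = 1 \<cdot>\<^sub>m G" using eichler_group_preserves[OF T(1)] by auto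
  from bform_mult_mat_vec[OF G_carrier eichler_group_carrier[OF T(1)] this T(3) T(3)] T(2)
  show ?thesis by simp
qed

text \<open>If \<open>T\<close> takes \<open>x\<close> to \<open>y\<close>, then the pairing of
  \<open>u\<close> with \<open>x\<close> equals that of \<open>T u\<close> with \<open>y\<close>,
  and \<open>T u\<close> is again integral.\<close>

lemma reach_dvd:
  assumes "reach x y" and "\<And>i. i < n + 4 \<Longrightarrow> d dvd B (unitf i) (($) y)" and "i < n + 4"
  shows "d dvd B (unitf i) (($) x)"
proof -
  obtain T where T: "T \<in> eichler_group n S" "y = T *\<^sub>v x" "x \<in> carrier_vec (n + 4)"
    using assms by (auto simp: reach_def)
  have u: "unit_vec (n + 4) i \<in> carrier_vec (n + 4)" by simp
  have "T\<^sup>T * G * T = 1 \<cdot>\<^sub>m G" using eichler_group_preserves[OF T(1)] by auto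
  from bform_mult_mat_vec[OF G_carrier eichler_group_carrier[OF T(1)] this u T(3)] T(2)
  have "B (($) (unit_vec (n + 4) i)) (($) x) = B (($) (T *\<^sub>v unit_vec (n + 4) i)) (($) y)" by simp
  moreover have "B (($) (unit_vec (n + 4) i)) (($) x) = B (unitf i) (($) x)"
    by (intro bform_cong) (auto simp: unitf_def unit_vec_def)
  moreover have "d dvd B z (($) y)" for z
    by (subst bform_expand, intro dvd_sum) (use assms(2) in auto)
  ultimately show ?thesis by simp
qed

text \<open>The form is even, so \<open>B a a div 2\<close> is an exact half and may serve as the
  parameter \<open>c\<close>.\<close>

lemma reach_eichler:
  assumes "x \<in> carrier_vec (n + 4)" "B e e = 0" "B e a = 0"
  obtains y where "reach x y"
    "\<And>i. i < n + 4 \<Longrightarrow> y $ i = x $ i - e i * B a (($) x) + a i * B e (($) x) - (B a a div 2) * e i * B e (($) x)"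
proof
  let ?E = "eichler (n + 4) G e a (B a a div 2)"
  have "?E * 1\<^sub>m (n + 4) \<in> eichler_group n S"
    using assms B_even by (intro eichler_group.step eichler_group.one) auto
  then have "?E \<in> eichler_group n S" by simp
  then show "reach x (?E *\<^sub>v x)" using assms by (auto simp: reach_def)
qed (use assms eichler_mult_vec in blast)

text \<open>The transvection with \<open>e = unitf 0\<close>. Orthogonality to \<open>e\<close> is
  \<open>a (n + 3) = 0\<close>; with \<open>a 0 = 0\<close> as well, \<open>a\<close> lives on the
  coordinates between the outer two. \<open>reach_last\<close> is the mirror image with
  \<open>e = unitf (n + 3)\<close>.\<close>

lemma reach_first:
  assumes x: "x \<in> carrier_vec (n + 4)" and a: "a 0 = 0" "a (n + 3) = 0"
  obtains y where "reach x y" "y $ 0 = x $ 0 - B a (($) x) - (B a a div 2) * x $ (n + 3)"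
    "y $ (n + 3) = x $ (n + 3)" "\<And>i. 0 < i \<Longrightarrow> i < n + 3 \<Longrightarrow> y $ i = x $ i + x $ (n + 3) * a i"
proof -
  have "B (unitf 0) (unitf 0) = 0" "B (unitf 0) a = 0"
    using a unfolding B_unitf by (auto simp: unitf_def)
  then obtain y where y: "reach x y" "\<And>i. i < n + 4 \<Longrightarrow> y $ i = x $ i - unitf 0 i * B a (($) x)
      + a i * B (unitf 0) (($) x) - (B a a div 2) * unitf 0 i * B (unitf 0) (($) x)"
    using reach_eichler[OF x] by blast
  show ?thesis
    using y(2)[unfolded B_unitf] a by (intro that[OF y(1)]) (simp_all add: unitf_def)
qed

lemma reach_last:
  assumes x: "x \<in> carrier_vec (n + 4)" and a: "a 0 = 0" "a (n + 3) = 0"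
  obtains y where "reach x y" "y $ (n + 3) = x $ (n + 3) - B a (($) x) - (B a a div 2) * x $ 0"
    "y $ 0 = x $ 0" "\<And>i. 0 < i \<Longrightarrow> i < n + 3 \<Longrightarrow> y $ i = x $ i + x $ 0 * a i"
proof -
  have "B (unitf (n + 3)) (unitf (n + 3)) = 0" "B (unitf (n + 3)) a = 0"
    using a unfolding B_unitf by (auto simp: unitf_def)
  then obtain y where y: "reach x y" "\<And>i. i < n + 4 \<Longrightarrow> y $ i = x $ i - unitf (n + 3) i * B a (($) x)
      + a i * B (unitf (n + 3)) (($) x) - (B a a div 2) * unitf (n + 3) i * B (unitf (n + 3)) (($) x)"
    using reach_eichler[OF x] by blast
  show ?thesis
    using y(2)[unfolded B_unitf] a by (intro that[OF y(1)]) (simp_all add: unitf_def)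
qed

text \<open>Here \<open>e = unitf 1\<close>, and the vanishing coordinate \<open>n + 2\<close> of
  \<open>x\<close> is its pairing with \<open>e\<close>. Only the term \<open>- e i * B a x\<close>
  survives, so the pairing with \<open>a\<close> can be written into coordinate \<open>1\<close>
  alone.\<close>

lemma reach_second:
  assumes x: "x \<in> carrier_vec (n + 4)" "x $ (n + 2) = 0" and a: "a (n + 2) = 0"
  obtains y where "reach x y" "y $ 1 = x $ 1 - B a (($) x)" "y $ 0 = x $ 0"
proof -
  have "B (unitf (Suc 0)) (unitf (Suc 0)) = 0" "B (unitf (Suc 0)) a = 0"
    using a unfolding B_unitf by (auto simp: unitf_def)
  then obtain y where y: "reach x y" "\<And>i. i < n + 4 \<Longrightarrow> y $ i = x $ i - unitf (Suc 0) i * B a (($) x)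
      + a i * B (unitf (Suc 0)) (($) x) - (B a a div 2) * unitf (Suc 0) i * B (unitf (Suc 0)) (($) x)"
    using reach_eichler[OF x(1)] by blast
  show ?thesis
    using y(2)[unfolded B_unitf] x(2) by (intro that[OF y(1)]) (simp_all add: unitf_def)
qed

lemma B_scaled_unitf:
  "B (\<lambda>i. k * unitf 1 i) y = k * y (n + 2)" "B (\<lambda>i. k * unitf (n + 2) i) y = k * y 1"
  "B (\<lambda>i. k * unitf 1 i + l * unitf (n + 2) i) y = k * y (n + 2) + l * y 1"
  using B_unitf(2,3) by (simp_all add: bform_scale bform_linear)

lemma reach_first_nonzero:
  assumes x: "x \<in> carrier_vec (n + 4)"
    and div: "\<And>d. (\<And>i. i < n + 4 \<Longrightarrow> d dvd B (unitf i) (($) x)) \<Longrightarrow> is_unit d"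
  shows "\<exists>y. reach x y \<and> y $ 0 \<noteq> 0"
proof -
  consider "x $ 0 \<noteq> 0" | "x $ 0 = 0" "x $ (n + 3) \<noteq> 0" | "x $ 0 = 0" "x $ (n + 3) = 0" by blast
  then show ?thesis
  proof cases
    case 1
    with reach_refl[OF x] show ?thesis by blast
  next
    case 2
    \<comment> \<open>The values for \<open>s = 1\<close> and \<open>s = -1\<close> add up to minus
      twice the nonzero coordinate \<open>n + 3\<close>, so at least one of them is nonzero.\<close>
    have *: "\<exists>y. reach x y \<and> y $ 0 = - (s * (x $ (n + 2) + x $ 1)) - x $ (n + 3)" if "s = 1 \<or> s = -1" for s
    proof -
      define a :: "nat \<Rightarrow> int" where "a = (\<lambda>i. s * unitf 1 i + s * unitf (n + 2) i)"
      have a: "a 0 = 0" "a (n + 3) = 0" "a 1 = s" "a (n + 2) = s" by (simp_all add: a_def unitf_def)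
      have Ba: "B a y = s * (y (n + 2) + y 1)" for y
        unfolding a_def B_scaled_unitf by (simp add: algebra_simps)
      have "B a a div 2 = 1" unfolding Ba using that a by auto
      moreover obtain y where "reach x y" "y $ 0 = x $ 0 - B a (($) x) - (B a a div 2) * x $ (n + 3)"
        using reach_first[OF x a(1,2)] by blast
      ultimately show ?thesis using 2 Ba by (intro exI[of _ y]) simp
    qed
    from *[of 1] *[of "-1"] 2 show ?thesis by (smt (verit))
  next
    case 3
    \<comment> \<open>If all pairings vanished, the hypothesis \<open>div\<close> with
      \<open>d = 0\<close> would make 0 a unit.\<close>
    have "\<exists>i<n+4. B (unitf i) (($) x) \<noteq> 0"
    proof (rule ccontr)
      assume "\<not> ?thesis"
      then have "is_unit (0::int)" by (intro div) auto
      then show False by simp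
    qed
    then obtain i where i: "i < n + 4" "B (unitf i) (($) x) \<noteq> 0" by blast
    with 3 have "i \<noteq> 0" "i \<noteq> n + 3" using B_unitf(1,4)[of "($) x"] by metis+
    then have "unitf i 0 = (0::int)" "unitf i (n + 3) = (0::int)" by (auto simp: unitf_def)
    then show ?thesis
      using reach_first[OF x, of "unitf i"] 3 i(2) by (metis diff_0 diff_zero mult_zero_right neg_equal_0_iff_equal)
  qed
qed

text \<open>Coordinates \<open>1\<close> and \<open>n + 2\<close> are dual to each other, so that division with remainder in one of
  them can be fed back into coordinate \<open>0\<close> through the other.\<close>

lemma reach_first_smaller:
  assumes x: "x \<in> carrier_vec (n + 4)" "x $ 0 \<noteq> 0"
    and jk: "(j = 1 \<and> k = n + 2) \<or> (j = n + 2 \<and> k = 1)" and ndvd: "\<not> x $ 0 dvd x $ j"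
  shows "\<exists>y. reach x y \<and> y $ 0 \<noteq> 0 \<and> \<bar>y $ 0\<bar> < \<bar>x $ 0\<bar>"
proof -
  define c where "c = \<bar>x $ 0\<bar>"
  define t where "t = sgn (x $ 0)"
  have Bj: "B (\<lambda>i. s * unitf j i) y = s * y k" "B (\<lambda>i. s * unitf k i) y = s * y j" for s y
    using jk B_scaled_unitf by auto
  have jk': "0 < j" "j < n + 3" "j \<noteq> k" "0 < k" "k < n + 3" using jk by auto
  have c: "c > 0" "x $ 0 = t * c" "t = 1 \<or> t = -1" using x by (auto simp: c_def t_def sgn_if)
  \<comment> \<open>Since \<open>t * t = 1\<close>, adding \<open>x $ 0 * q\<close> subtracts
    \<open>c * (x $ j div c)\<close> and leaves the remainder modulo \<open>c\<close> in coordinate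
    \<open>j\<close>.\<close>
  define q where "q = - (x $ j div c) * t"
  have u: "s * unitf j 0 = (0::int)" "s * unitf j (n + 3) = (0::int)"
    "s * unitf k 0 = (0::int)" "s * unitf k (n + 3) = (0::int)" for s
    using jk' by (simp_all add: unitf_def)
  obtain y where y: "reach x y" "y $ 0 = x $ 0"
    and "\<And>i. 0 < i \<Longrightarrow> i < n + 3 \<Longrightarrow> y $ i = x $ i + x $ 0 * (q * unitf j i)"
    using reach_last[of x "\<lambda>i. q * unitf j i", OF x(1) u(1,2)] by blast
  then have "y $ j = x $ j + x $ 0 * (q * unitf j j)" using jk' by blast
  also have "\<dots> = x $ j - c * (x $ j div c)"
    using c by (auto simp: q_def unitf_def)
  finally have yj: "y $ j = x $ j mod c" by (simp add: minus_mult_div_eq_mod)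
  have "y $ j \<noteq> 0" using ndvd yj by (simp add: c_def mod_eq_0_iff_dvd)
  with yj c(1) pos_mod_bound[of c "x $ j"] pos_mod_sign[of c "x $ j"]
  have yj': "0 < y $ j" "y $ j < c" by linarith+
  have "B (\<lambda>i. t * unitf k i) (\<lambda>i. t * unitf k i) = 0"
    unfolding Bj using jk' by (simp add: unitf_def)
  moreover have "y \<in> carrier_vec (n + 4)" using reach_carrier[OF y(1)] by blast
  \<comment> \<open>The new coordinate \<open>0\<close> is \<open>t * (c - y $ j)\<close>; as the
    remainder lies strictly between 0 and \<open>c\<close>, so does the absolute value of this
    coordinate.\<close>
  ultimately obtain z where z: "reach y z" "z $ 0 = y $ 0 - t * y $ j"
    using reach_first[of y "\<lambda>i. t * unitf k i", OF _ u(3,4)] Bj(2)[of t "($) y"] by auto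
  have "z $ 0 = t * (c - y $ j)" using z(2) y(2) c(2) by (simp add: algebra_simps)
  then have "z $ 0 \<noteq> 0 \<and> \<bar>z $ 0\<bar> < c" using yj' c(3) by auto
  with reach_trans[OF y(1) z(1)] show ?thesis by (auto simp: c_def)
qed

text \<open>Choose \<open>y\<close> in the orbit with the least nonzero absolute value of coordinate
  \<open>0\<close>. By \<open>reach_first_smaller\<close> this entry divides coordinates
  \<open>1\<close> and \<open>n + 2\<close> of every orbit element with the same coordinate
  \<open>0\<close>. Moving every other pairing into coordinate \<open>1\<close> shows that it
  divides all pairings, so it is a unit.\<close>

lemma reach_first_unit:
  assumes x: "x \<in> carrier_vec (n + 4)"
    and div: "\<And>d. (\<And>i. i < n + 4 \<Longrightarrow> d dvd B (unitf i) (($) x)) \<Longrightarrow> is_unit d"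
  shows "\<exists>w. reach x w \<and> \<bar>w $ 0\<bar> = 1 \<and> w $ 1 = 0 \<and> w $ (n + 2) = 0"
proof -
  define P where "P = (\<lambda>y. reach x y \<and> y $ 0 \<noteq> 0)"
  obtain y where Py: "P y" and min: "\<And>z. P z \<Longrightarrow> \<bar>y $ 0\<bar> \<le> \<bar>z $ 0\<bar>"
    using ex_has_least_nat[of P _ "\<lambda>y. nat \<bar>y $ 0\<bar>"] reach_first_nonzero[OF assms]
    unfolding P_def by (metis eq_nat_nat_iff abs_ge_zero nat_le_eq_zle nat_0_le nat_mono nle_le)
  have dvd: "y $ 0 dvd z $ j" if "reach x z" "z $ 0 = y $ 0" "j = 1 \<or> j = n + 2" for z j
  proof (rule ccontr)
    assume nd: "\<not> y $ 0 dvd z $ j"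
    have jk: "(j = 1 \<and> n + 3 - j = n + 2) \<or> (j = n + 2 \<and> n + 3 - j = 1)" using that(3) by auto
    have "z \<in> carrier_vec (n + 4)" "z $ 0 \<noteq> 0" "\<not> z $ 0 dvd z $ j"
      using reach_carrier[OF that(1)] Py that(2) nd by (auto simp: P_def)
    from reach_first_smaller[OF this(1,2) jk this(3)] show False using min that reach_trans unfolding P_def by (metis not_le)
  qed
  have y: "reach x y" "y $ 0 \<noteq> 0" using Py by (auto simp: P_def)
  define k where "k = - (y $ 1 div y $ 0)"
  define l where "l = - (y $ (n + 2) div y $ 0)"
  define a where "a = (\<lambda>i. k * unitf 1 i + l * unitf (n + 2) i)"
  have a: "a 0 = 0" "a (n + 3) = 0" "a 1 = k" "a (n + 2) = l" by (simp_all add: a_def unitf_def)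
  obtain w where w: "reach y w" "w $ 0 = y $ 0" and "\<And>i. 0 < i \<Longrightarrow> i < n + 3 \<Longrightarrow> w $ i = y $ i + y $ 0 * a i"
    using reach_last[of y a, OF _ a(1,2)] reach_carrier[OF y(1)] by blast
  then have "w $ 1 = y $ 1 + y $ 0 * a 1" "w $ (n + 2) = y $ (n + 2) + y $ 0 * a (n + 2)" by simp_all
  then have w0: "w $ 1 = 0" "w $ (n + 2) = 0"
    using dvd[OF y(1) refl, of 1] dvd[OF y(1) refl, of "n + 2"] a by (simp_all add: k_def l_def)
  have xw: "reach x w" using reach_trans y(1) w(1) by blast
  have wc: "w \<in> carrier_vec (n + 4)" using reach_carrier[OF xw] by blast
  \<comment> \<open>Since coordinates \<open>1\<close> and \<open>n + 2\<close> of \<open>w\<close>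
    are cleared, \<open>reach_first\<close> with \<open>unitf 1\<close> copies coordinate
    \<open>n + 3\<close> into coordinate \<open>1\<close> and leaves coordinate \<open>0\<close>
    alone.\<close>
  have d3: "y $ 0 dvd w $ (n + 3)"
  proof -
    have "B (unitf 1) (unitf 1) = 0" "B (unitf 1) (($) w) = 0"
      using B_unitf(2) w0 by (simp_all add: unitf_def)
    then obtain z where "reach w z" "z $ 0 = w $ 0"
      and "\<And>i. 0 < i \<Longrightarrow> i < n + 3 \<Longrightarrow> z $ i = w $ i + w $ (n + 3) * unitf 1 i"
      using reach_first[of w "unitf 1", OF wc] by (auto simp: unitf_def)
    moreover from this have "z $ 1 = w $ 1 + w $ (n + 3) * unitf 1 1" by simp
    ultimately show ?thesis
      using dvd[of z 1] reach_trans[OF xw] w(2) w0 by (simp add: unitf_def)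
  qed
  \<comment> \<open>For the middle indices \<open>reach_second\<close> writes the pairing, up to
    sign, into coordinate \<open>1\<close>.\<close>
  have dS: "y $ 0 dvd B (unitf (j + 2)) (($) w)" if "j < n" for j
  proof -
    have "unitf (j + 2) (n + 2) = (0::int)" using that by (simp add: unitf_def)
    then obtain z where "reach w z" "z $ 1 = w $ 1 - B (unitf (j + 2)) (($) w)" "z $ 0 = w $ 0"
      using reach_second[of w "unitf (j + 2)", OF wc w0(2)] by metis
    then show ?thesis
      using dvd[of z 1] reach_trans[OF xw] w(2) w0 by simp
  qed
  have "y $ 0 dvd B (unitf i) (($) w)" if "i < n + 4" for i
    by (rule index_cases[OF that]) (use d3 dS w0 w(2) B_unitf(1-4)[of "($) w"] in auto)
  then have "is_unit (y $ 0)"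
    using div reach_dvd[OF xw] by blast
  with w(2) w0 xw show ?thesis by (metis zdvd1_eq)
qed

text \<open>Once coordinate \<open>0\<close> is 1, \<open>reach_last\<close> clears the coordinates
  strictly between the outer two. The norm is then twice coordinate \<open>n + 3\<close>, which
  therefore vanishes by isotropy.\<close>

lemma eichler_criterion:
  assumes x: "x \<in> carrier_vec (n + 4)" and iso: "B (($) x) (($) x) = 0"
    and div: "\<And>d. (\<And>i. i < n + 4 \<Longrightarrow> d dvd B (unitf i) (($) x)) \<Longrightarrow> is_unit d"
  shows "reach x (unit_vec (n + 4) 0)"
proof -
  obtain w where w: "reach x w" "\<bar>w $ 0\<bar> = 1" "w $ 1 = 0"
    using reach_first_unit[OF x div] by blast
  have "\<exists>y. reach x y \<and> y $ 0 = 1"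
  proof (cases "w $ 0 = 1")
    case True
    with w show ?thesis by blast
  next
    case False
    with w have w0: "w $ 0 = -1" by linarith
    \<comment> \<open>The sign is corrected by first putting -2 into coordinate \<open>1\<close> and
      then subtracting this entry from coordinate \<open>0\<close>.\<close>
    have u: "2 * unitf 1 0 = (0::int)" "2 * unitf 1 (n + 3) = (0::int)"
      "unitf (n + 2) 0 = (0::int)" "unitf (n + 2) (n + 3) = (0::int)"
      by (simp_all add: unitf_def)
    obtain y where y: "reach w y" "y $ 0 = w $ 0"
      and "\<And>i. 0 < i \<Longrightarrow> i < n + 3 \<Longrightarrow> y $ i = w $ i + w $ 0 * (2 * unitf 1 i)"
      using reach_last[of w "\<lambda>i. 2 * unitf 1 i", OF _ u(1,2)] reach_carrier[OF w(1)] by blast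
    then have y1: "y $ 1 = -2" using w0 w(3) by (simp add: unitf_def)
    have "B (unitf (n + 2)) (unitf (n + 2)) = 0" "B (unitf (n + 2)) (($) y) = -2"
      using y1 unfolding B_unitf by (simp_all add: unitf_def)
    moreover have "y \<in> carrier_vec (n + 4)" using reach_carrier[OF y(1)] by blast
    ultimately obtain z where z: "reach y z" "z $ 0 = y $ 0 - (-2)"
      using reach_first[of y "unitf (n + 2)", OF _ u(3,4)] by auto
    then show ?thesis
      using reach_trans[OF reach_trans[OF w(1) y(1)] z(1)] y(2) z(2) w0 by auto
  qed
  then obtain y where y: "reach x y" "y $ 0 = 1" by blast
  define a where "a = (\<lambda>i. if i = 0 \<or> i = n + 3 then 0 else - y $ i)"
  have "a 0 = 0" "a (n + 3) = 0" by (simp_all add: a_def)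
  then obtain z where z: "reach y z" "z $ 0 = y $ 0" "\<And>i. 0 < i \<Longrightarrow> i < n + 3 \<Longrightarrow> z $ i = y $ i + y $ 0 * a i"
    using reach_last[of y a] reach_carrier[OF y(1)] by blast
  have z0: "z $ 0 = 1" "\<And>i. 0 < i \<Longrightarrow> i < n + 3 \<Longrightarrow> z $ i = 0"
    using z y by (auto simp: a_def)
  have xz: "reach x z" using reach_trans[OF y(1) z(1)] .
  have zc: "z \<in> carrier_vec (n + 4)" using reach_carrier[OF xz] by blast
  have "bform n S (\<lambda>i. z $ (i + 2)) (\<lambda>i. z $ (i + 2)) = bform n S (\<lambda>i. 0) (\<lambda>i. z $ (i + 2))"
    using z0 by (intro bform_cong) auto
  then have "B (($) z) (($) z) = 2 * z $ (n + 3)"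
    unfolding B_eq using z0 by simp
  then have z3: "z $ (n + 3) = 0"
    using reach_bform[OF xz] iso by simp
  have "z = unit_vec (n + 4) 0"
  proof (rule eq_vecI)
    fix i assume "i < dim_vec (unit_vec (n + 4) 0)"
    then consider "i = 0" | "0 < i" "i < n + 3" | "i = n + 3" "i < n + 4" by fastforce
    then show "z $ i = unit_vec (n + 4) 0 $ i"
      by cases (use z0 z3 in auto)
  qed (use zc in simp)
  with xz show ?thesis by simp
qed

section \<open>Integrality of isotropic dual vectors\<close>

lemma S_sym_bform: "bform n S x y = bform n S y x"
  by (rule bform_sym[OF S_carrier S_sym])

lemma bform_S_even: "even (bform n S x x)"
  using S_entry_sym S_even by (intro even_bform) auto

lemma dvd_bform_S:
  assumes "\<And>j. j < n \<Longrightarrow> p dvd bform n S (unitf j) w"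
  shows "p dvd bform n S x w"
  by (subst bform_expand, intro dvd_sum) (use assms in auto)

text \<open>The lattice \<open>\<int>\<^sup>n + \<int> w/p\<close> is even. Since \<open>w i0 = 1\<close>, replacing the \<open>i0\<close>-th standard basis
  vector by \<open>w/p\<close> gives a basis of it.\<close>

lemma maximal_even_prime_normalized:
  fixes p :: int
  assumes max: "maximal_even n S" and p: "p > 1" and i0: "i0 < n" and wi0: "w i0 = 1"
    and Sw: "\<And>j. j < n \<Longrightarrow> p dvd bform n S (unitf j) w" and ww: "2 * p\<^sup>2 dvd bform n S w w"
  shows False
proof -
  \<comment> \<open>\<open>C\<close> is the inverse of \<open>A\<close>; that it is integral puts
    the standard lattice inside the new one. Column \<open>i0\<close> expresses the lost basis
    vector as \<open>p\<close> times \<open>w/p\<close> minus the other components of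
    \<open>w\<close>.\<close>
  define C :: "int mat" where
    "C = mat n n (\<lambda>(i, j). if j = i0 then if i = i0 then p else - w i else if i = j then 1 else 0)"
  define A :: "rat mat" where
    "A = mat n n (\<lambda>(i, j). if j = i0 then of_int (w i) / of_int p else if i = j then 1 else 0)"
  let ?C = "map_mat rat_of_int C"
  \<comment> \<open>Dropping coordinate \<open>i0\<close> from \<open>z\<close> lets
    \<open>p\<close> times the lattice vector given by \<open>z\<close> be written as
    \<open>z $ i0 * w + p * x z\<close>.\<close>
  define x where "x = (\<lambda>z i. if i = i0 then 0 else z $ i :: int)"
  have C: "C \<in> carrier_mat n n" and A: "A \<in> carrier_mat n n" by (simp_all add: C_def A_def)
  have A_mult: "(A *\<^sub>v v) $ i = v $ i0 * of_int (w i) / of_int p + (if i = i0 then 0 else v $ i)"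
    if "i < n" "v \<in> carrier_vec n" for v i
  proof -
    have "(A *\<^sub>v v) $ i = (\<Sum>j<n. (if j = i0 then of_int (w i) / of_int p else if i = j then 1 else 0) * v $ j)"
      using that by (simp add: A_def scalar_prod_def atLeast0LessThan)
    also have "\<dots> = (\<Sum>j<n. (if j = i0 then v $ i0 * of_int (w i) / of_int p else 0)
        + (if j = i then (if i = i0 then 0 else v $ i) else 0))"
      by (intro sum.cong) auto
    also have "\<dots> = v $ i0 * of_int (w i) / of_int p + (if i = i0 then 0 else v $ i)"
      using that i0 by (simp add: sum.distrib)
    finally show ?thesis .
  qed
  have AC: "A * ?C = 1\<^sub>m n"
  proof (rule eq_matI)
    fix i j assume "i < dim_row (1\<^sub>m n)" "j < dim_col (1\<^sub>m n)"
    then have ij: "i < n" "j < n" by auto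
    have "(A * ?C) $$ (i, j) = (A *\<^sub>v col ?C j) $ i" using ij A C by simp
    also have "\<dots> = 1\<^sub>m n $$ (i, j)"
      using ij p i0 C wi0 by (subst A_mult) (auto simp: C_def)
    finally show "(A * ?C) $$ (i, j) = 1\<^sub>m n $$ (i, j)" .
  qed (use A C in auto)
  define \<Lambda> where "\<Lambda> = {A *\<^sub>v map_vec rat_of_int z | z. z \<in> carrier_vec n}"
  have "invertible_mat A"
    using AC A C mat_mult_left_right_inverse[OF A _ AC]
    by (auto simp: invertible_mat_def inverts_mat_def square_mat.simps)
  then have "rat_lattice n \<Lambda>"
    unfolding rat_lattice_def \<Lambda>_def using A by blast
  moreover have "std_lattice n \<subseteq> \<Lambda>"
  proof
    fix v assume "v \<in> std_lattice n"
    then obtain z where z: "z \<in> carrier_vec n" "v = map_vec rat_of_int z"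
      by (auto simp: std_lattice_def)
    have "A *\<^sub>v map_vec rat_of_int (C *\<^sub>v z) = A *\<^sub>v (?C *\<^sub>v v)"
      using of_int_hom.mult_mat_vec_hom[OF C z(1), where 'a = rat] z(2) by simp
    also have "\<dots> = (A * ?C) *\<^sub>v v"
      using A C z by (intro assoc_mult_mat_vec[symmetric]) auto
    also have "\<dots> = v" using z by (simp add: AC)
    finally show "v \<in> \<Lambda>"
      unfolding \<Lambda>_def using C z(1) by (intro CollectI exI[of _ "C *\<^sub>v z"]) auto
  qed
  moreover have "A *\<^sub>v map_vec rat_of_int (unit_vec n i0) \<in> \<Lambda> - std_lattice n"
  proof -
    let ?v = "A *\<^sub>v map_vec rat_of_int (unit_vec n i0)"
    have "?v $ i0 = 1 / of_int p" using i0 wi0 by (subst A_mult) auto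
    have "?v \<notin> std_lattice n"
    proof
      assume "?v \<in> std_lattice n"
      then obtain z where "?v = map_vec rat_of_int z" "z \<in> carrier_vec n" by (auto simp: std_lattice_def)
      then have "rat_of_int (z $ i0) * of_int p = 1"
        using \<open>?v $ i0 = 1 / of_int p\<close> i0 p by (simp add: field_simps)
      then have "z $ i0 * p = 1" by (metis of_int_eq_1_iff of_int_mult)
      then have "p dvd 1" by (metis dvd_triv_right)
      then show False using p by simp
    qed
    moreover have "?v \<in> \<Lambda>" unfolding \<Lambda>_def by auto
    ultimately show ?thesis by blast
  qed
  moreover have "\<exists>k::int. v \<bullet> (map_mat rat_of_int S *\<^sub>v v) = rat_of_int (2 * k)" if v: "v \<in> \<Lambda>" for v
  proof -
    obtain z where z: "z \<in> carrier_vec n" "v = A *\<^sub>v map_vec rat_of_int z" using v by (auto simp: \<Lambda>_def)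
    let ?t = "\<lambda>i. z $ i0 * w i + p * x z i"
    have vc: "v \<in> carrier_vec n" using z A by simp
    have "v $ i = 1 / of_int p * of_int (?t i)" if "i < n" for i
      unfolding z(2) using that z(1) p i0 by (subst A_mult) (auto simp: x_def field_simps)
    then have "v \<bullet> (map_mat rat_of_int S *\<^sub>v v) =
       bform n (map_mat rat_of_int S) (\<lambda>i. 1 / of_int p * of_int (?t i)) (\<lambda>i. 1 / of_int p * of_int (?t i))"
      using vc by (subst scalar_prod_mult_mat_vec[of _ n]) (auto intro!: bform_cong)
    also have "\<dots> = of_int (bform n S ?t ?t) / of_int (p\<^sup>2)"
      by (simp only: bform_scale of_int_bform[OF S_carrier]) (simp add: power2_eq_square)
    \<comment> \<open>Each of the three terms is a multiple of \<open>2 * p\<^sup>2\<close>: by the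
      norm of \<open>w\<close>, by its pairings, and by evenness of \<open>S\<close>.\<close>
    also have "bform n S ?t ?t = z $ i0 * z $ i0 * bform n S w w
        + 2 * (p * (z $ i0 * bform n S (x z) w)) + p * p * bform n S (x z) (x z)"
      by (simp only: bform_linear bform_scale S_sym_bform[of w "x z"]) (simp add: algebra_simps)
    finally have eq: "v \<bullet> (map_mat rat_of_int S *\<^sub>v v) = of_int (z $ i0 * z $ i0 * bform n S w w
        + 2 * (p * (z $ i0 * bform n S (x z) w)) + p * p * bform n S (x z) (x z)) / of_int (p\<^sup>2)" .
    obtain k1 where k1: "bform n S w w = 2 * p\<^sup>2 * k1" using ww by (auto simp: dvd_def)
    obtain k2 where k2: "bform n S (x z) w = p * k2" using dvd_bform_S[OF Sw, of "x z"] by (auto simp: dvd_def)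
    obtain k3 where k3: "bform n S (x z) (x z) = 2 * k3" using bform_S_even[of "x z"] by (auto simp: dvd_def)
    have "v \<bullet> (map_mat rat_of_int S *\<^sub>v v)
       = of_int (2 * (z $ i0 * z $ i0 * k1 + z $ i0 * k2 + k3) * p\<^sup>2) / of_int (p\<^sup>2)"
      unfolding eq k1 k2 k3 by (simp add: algebra_simps power2_eq_square)
    also have "\<dots> = of_int (2 * (z $ i0 * z $ i0 * k1 + z $ i0 * k2 + k3))"
      using p by simp
    finally show ?thesis by blast
  qed
  ultimately show False
    using max unfolding maximal_even_def by blast
qed

text \<open>Otherwise \<open>l i\<close> has an inverse \<open>u\<close> modulo \<open>p\<close>.
  Correcting \<open>u * l\<close> in coordinate \<open>i\<close> by a multiple of \<open>p\<close>
  gives a \<open>w\<close> with \<open>w i = 1\<close>; it keeps both divisibility properties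
  because \<open>S\<close> is even, so the normalized case applies.\<close>

lemma maximal_even_prime:
  fixes p :: int
  assumes max: "maximal_even n S" and p: "prime p"
    and Sl: "\<And>j. j < n \<Longrightarrow> p dvd bform n S (unitf j) l" and ll: "2 * p\<^sup>2 dvd bform n S l l"
    and i: "i < n"
  shows "p dvd l i"
proof (rule ccontr)
  assume "\<not> p dvd l i"
  then have "coprime (l i) p"
    using p by (metis coprime_commute prime_imp_coprime)
  then obtain u where "[l i * u = 1] (mod p)" by (rule cong_solve_coprime_int[THEN exE])
  then have "p dvd 1 - u * l i" by (metis cong_iff_dvd_diff cong_sym mult.commute)
  then obtain s where s: "1 - u * l i = p * s" by (auto simp: dvd_def)
  define w where "w = (\<lambda>k. u * l k + p * s * unitf i k)"
  have Sw: "bform n S x w = u * bform n S x l + p * s * bform n S x (unitf i)" for x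
    by (simp only: w_def bform_linear bform_scale) 
  have "w i = 1" using s by (simp add: w_def unitf_def)
  moreover have "p dvd bform n S (unitf j) w" if "j < n" for j
    using Sl[OF that] by (simp add: Sw)
  moreover have "2 * p\<^sup>2 dvd bform n S w w"
  proof -
    have "bform n S w w = u * bform n S w l + p * s * bform n S w (unitf i)" by (rule Sw)
    also have "bform n S w l = u * bform n S l l + p * s * bform n S (unitf i) l"
      using Sw[of l] S_sym_bform by metis
    also have "bform n S w (unitf i) = u * bform n S (unitf i) l + p * s * bform n S (unitf i) (unitf i)"
      using Sw[of "unitf i"] S_sym_bform by metis
    finally have eq: "bform n S w w = u * u * bform n S l l + 2 * (u * (p * (s * bform n S (unitf i) l)))
       + p * p * (s * s * bform n S (unitf i) (unitf i))" by (simp add: algebra_simps)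
    obtain k1 where k1: "bform n S l l = 2 * p\<^sup>2 * k1" using ll by (auto simp: dvd_def)
    obtain k2 where k2: "bform n S (unitf i) l = p * k2" using Sl[OF i] by (auto simp: dvd_def)
    obtain k3 where k3: "bform n S (unitf i) (unitf i) = 2 * k3" using bform_S_even[of "unitf i"] by (auto simp: dvd_def)
    have "bform n S w w = 2 * p\<^sup>2 * (u * u * k1 + u * s * k2 + s * s * k3)"
      unfolding eq k1 k2 k3 by (simp add: algebra_simps power2_eq_square)
    then show ?thesis by simp
  qed
  ultimately show False
    using maximal_even_prime_normalized[OF max _ i, of p w] prime_gt_1_int[OF p] by blast
qed

text \<open>One prime \<open>p\<close> of \<open>D\<close> is removed at a time: \<open>p\<close>
  divides \<open>l\<close>, and after division the pairings lose one factor \<open>p\<close> and the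
  norm loses two, which are the hypotheses for \<open>D\<close> divided by \<open>p\<close>.\<close>

lemma maximal_even_dvd:
  assumes max: "maximal_even n S"
  shows "D > 0 \<Longrightarrow> (\<And>j. j < n \<Longrightarrow> int D dvd bform n S (unitf j) l) \<Longrightarrow>
    2 * (int D)\<^sup>2 dvd bform n S l l \<Longrightarrow> i < n \<Longrightarrow> int D dvd l i"
proof (induction D arbitrary: l i rule: less_induct)
  case (less D)
  show ?case
  proof (cases "D = 1")
    case False
    then obtain p where p: "prime p" "p dvd D" by (metis prime_factor_nat)
    then obtain E where E: "D = p * E" by (auto simp: dvd_def)
    have pD: "int D = int p * int E" using E by simp
    have "int p dvd l k" if "k < n" for k
    proof (rule maximal_even_prime[OF max _ _ _ that])
      show "prime (int p)" using p by simp
      show "int p dvd bform n S (unitf j) l" if "j < n" for j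
        using less.prems(2)[OF that] pD by (metis dvd_mult_left)
      show "2 * (int p)\<^sup>2 dvd bform n S l l"
        using less.prems(3) unfolding pD power_mult_distrib by (metis dvd_mult_left mult.assoc)
    qed
    then have l: "l k = int p * (l k div int p)" if "k < n" for k using that by simp
    define l' where "l' = (\<lambda>k. l k div int p)"
    have p0: "int p > 0" using p prime_gt_0_nat by simp
    have b1: "bform n S x l = int p * bform n S x l'" for x
    proof -
      have "bform n S x l = bform n S x (\<lambda>k. int p * l' k)"
        using l by (intro bform_cong) (auto simp: l'_def)
      then show ?thesis by (simp add: bform_scale)
    qed
    have b2: "bform n S l l = (int p)\<^sup>2 * bform n S l' l'"
      using b1[of l] b1[of l'] S_sym_bform[of l l'] by (simp add: power2_eq_square)
    have "int E dvd l' k" if "k < n" for k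
    proof (rule less.IH)
      show "E < D" "0 < E" using less.prems(1) E prime_gt_1_nat[OF p(1)] by auto
      show "int E dvd bform n S (unitf j) l'" if "j < n" for j
        using less.prems(2)[OF that] p0 unfolding b1 pD by simp
      have "(int p)\<^sup>2 * (2 * (int E)\<^sup>2) dvd (int p)\<^sup>2 * bform n S l' l'"
        using less.prems(3) unfolding b2 pD by (simp add: power_mult_distrib mult_ac)
      then show "2 * (int E)\<^sup>2 dvd bform n S l' l'" using p0 by simp
    qed (rule that)
    then show ?thesis
      using l[OF less.prems(4)] less.prems(4) unfolding pD l'_def by (metis mult_dvd_mono dvd_refl)
  qed simp
qed

text \<open>The outer coordinates are themselves pairings. By isotropy the \<open>S\<close>-norm of
  the middle part is twice a sum of two products of outer coordinates, hence divisible by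
  \<open>2 * D\<^sup>2\<close>, as \<open>maximal_even_dvd\<close> requires.\<close>

lemma maximal_even_isotropic_dvd:
  assumes max: "maximal_even n S" and D: "D \<noteq> 0"
    and div: "\<And>i. i < n + 4 \<Longrightarrow> D dvd B (unitf i) y" and iso: "B y y = 0" and i: "i < n + 4"
  shows "D dvd y i"
proof -
  have y: "D dvd y 0" "D dvd y 1" "D dvd y (n + 2)" "D dvd y (n + 3)"
    using div[of "n + 3"] div[of "n + 2"] div[of "Suc 0"] div[of 0] unfolding B_unitf by simp_all
  have Dn: "int (nat \<bar>D\<bar>) = \<bar>D\<bar>" by simp
  have mid: "D dvd y (j + 2)" if "j < n" for j
  proof -
    have "int (nat \<bar>D\<bar>) dvd y (j + 2)"
    proof (rule maximal_even_dvd[OF max, of "nat \<bar>D\<bar>" "\<lambda>i. y (i + 2)"])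
      show "int (nat \<bar>D\<bar>) dvd bform n S (unitf k) (\<lambda>i. y (i + 2))" if "k < n" for k
        using div[of "k + 2"] that B_unitf(5)[OF that, of y] by (simp add: bform_unitf_left)
      have "bform n S (\<lambda>i. y (i + 2)) (\<lambda>i. y (i + 2)) = 2 * (y 0 * y (n + 3) + y 1 * y (n + 2))"
        using iso unfolding B_eq by (simp add: algebra_simps)
      moreover have "2 * (D * D) dvd 2 * (y 0 * y (n + 3) + y 1 * y (n + 2))"
        using y by (intro mult_dvd_mono dvd_add) auto
      ultimately show "2 * (int (nat \<bar>D\<bar>))\<^sup>2 dvd bform n S (\<lambda>i. y (i + 2)) (\<lambda>i. y (i + 2))"
        by (simp add: power2_eq_square)
    qed (use D that in auto)
    then show ?thesis by simp
  qed
  show ?thesis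
    by (rule index_cases[OF i]) (use y mid in auto)
qed

text \<open>For nonzero \<open>D\<close> the vector \<open>y/D\<close> lies in the dual lattice, and
  \<open>det S\<close> times the dual lattice is integral by the adjugate of
  \<open>S\<close>.\<close>

lemma dvd_det_mult:
  assumes div: "\<And>i. i < n + 4 \<Longrightarrow> D dvd B (unitf i) y" and i: "i < n + 4"
  shows "D dvd Determinant.det S * y i"
proof -
  have y: "D dvd y 0" "D dvd y 1" "D dvd y (n + 2)" "D dvd y (n + 3)"
    using div[of "n + 3"] div[of "n + 2"] div[of "Suc 0"] div[of 0] unfolding B_unitf by simp_all
  define l where "l = vec n (\<lambda>k. y (k + 2))"
  have mid: "D dvd Determinant.det S * y (j + 2)" if "j < n" for j
  proof -
    have "(S *\<^sub>v l) $ k = - B (unitf (k + 2)) y" if "k < n" for k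
      using that B_unitf(5)[OF that, of y] by (simp add: l_def scalar_prod_def atLeast0LessThan)
    then have Sl: "D dvd (S *\<^sub>v l) $ k" if "k < n" for k
      using that div[of "k + 2"] by simp
    have "Determinant.det S * y (j + 2) = (adj_mat S *\<^sub>v (S *\<^sub>v l)) $ j"
      using adj_mat_mult_vec[OF S_carrier _ that, of l] that by (simp add: l_def)
    also have "\<dots> = (\<Sum>k<n. adj_mat S $$ (j, k) * (S *\<^sub>v l) $ k)"
      using that adj_mat(1)[OF S_carrier] by (simp add: scalar_prod_def atLeast0LessThan)
    finally show ?thesis using Sl by (auto intro!: dvd_sum)
  qed
  show ?thesis
    by (rule index_cases[OF i]) (use y mid in auto)
qed

section \<open>Similitudes\<close>

text \<open>Phrased by columns, because the reductions act on single columns;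
  \<open>similitude_iff\<close> is the matrix form. Working with the factor \<open>r\<close> keeps
  the square root out of the integral arguments.\<close>

definition similitude :: "int \<Rightarrow> int mat \<Rightarrow> bool" where
  "similitude r R \<longleftrightarrow> R \<in> carrier_mat (n + 4) (n + 4) \<and>
     (\<forall>i<n+4. \<forall>j<n+4. B (\<lambda>k. R $$ (k, i)) (\<lambda>k. R $$ (k, j)) = r * G $$ (i, j))"

lemma similitude_carrier: "similitude r R \<Longrightarrow> R \<in> carrier_mat (n + 4) (n + 4)"
  by (simp add: similitude_def)

lemma similitude_col: "similitude r R \<Longrightarrow> i < n + 4 \<Longrightarrow> j < n + 4 \<Longrightarrow>
    B (\<lambda>k. R $$ (k, i)) (\<lambda>k. R $$ (k, j)) = r * B (unitf i) (unitf j)"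
  by (simp add: similitude_def bform_unitf_unitf)

lemma similitude_iff:
  assumes "R \<in> carrier_mat (n + 4) (n + 4)"
  shows "similitude r R \<longleftrightarrow> R\<^sup>T * G * R = r \<cdot>\<^sub>m G"
proof
  assume "similitude r R"
  then show "R\<^sup>T * G * R = r \<cdot>\<^sub>m G"
    using transpose_mult_bform[OF G_carrier assms] assms
    by (intro eq_matI) (auto simp: similitude_def)
next
  assume "R\<^sup>T * G * R = r \<cdot>\<^sub>m G"
  then show "similitude r R"
    using transpose_mult_bform[OF G_carrier assms] assms
    by (auto simp: similitude_def)
qed

lemma eichler_group_similitude: "M \<in> eichler_group n S \<Longrightarrow> similitude 1 M"
  using eichler_group_preserves eichler_group_carrier by (subst similitude_iff) auto

lemma similitude_mult:
  assumes "similitude r R" "similitude s Q"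
  shows "similitude (r * s) (R * Q)"
proof -
  have R: "R \<in> carrier_mat (n + 4) (n + 4)" and Q: "Q \<in> carrier_mat (n + 4) (n + 4)"
    using assms by (auto simp: similitude_def)
  have RG: "R\<^sup>T * G * R = r \<cdot>\<^sub>m G" using assms(1) similitude_iff R by blast
  have "B (\<lambda>k. (R * Q) $$ (k, i)) (\<lambda>k. (R * Q) $$ (k, j)) = r * s * G $$ (i, j)"
    if ij: "i < n + 4" "j < n + 4" for i j
  proof -
    have c: "(R *\<^sub>v col Q l) $ k = (R * Q) $$ (k, l)" if "k < n + 4" "l < n + 4" for k l
      using that R Q by simp
    have "B (\<lambda>k. (R * Q) $$ (k, i)) (\<lambda>k. (R * Q) $$ (k, j)) =
        B (($) (R *\<^sub>v col Q i)) (($) (R *\<^sub>v col Q j))"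
      using ij c by (intro bform_cong) auto
    also have "\<dots> = r * B (($) (col Q i)) (($) (col Q j))"
      using Q by (intro bform_mult_mat_vec[OF G_carrier R RG] col_carrier_vec) (use ij in auto)
    also have "B (($) (col Q i)) (($) (col Q j)) = B (\<lambda>k. Q $$ (k, i)) (\<lambda>k. Q $$ (k, j))"
      using Q ij by (intro bform_cong) auto
    finally show ?thesis using assms(2) ij by (simp add: similitude_def)
  qed
  with R Q show ?thesis by (simp add: similitude_def)
qed

section \<open>Reduction of the first column and representatives of right cosets\<close>

lemma dvd_B:
  assumes "\<And>i. i < n + 4 \<Longrightarrow> d dvd x i"
  shows "d dvd B x y"
  by (subst bform_expand, intro dvd_sum) (use assms in auto)

text \<open>Columns \<open>0\<close> and \<open>n + 3\<close> of \<open>R\<close> pair to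
  \<open>r\<close>. Hence the gcd \<alpha> divides \<open>r\<close>, and so does every common
  divisor \<open>d\<close> of the pairings with the primitive vector \<open>x\<close>. The
  hypothesis on \<open>S\<close> and \<open>r\<close> transfers \<open>d\<close> to the entries of
  \<open>x\<close>, whose gcd is 1.\<close>

lemma first_column:
  assumes sim: "similitude r R" and r: "r \<noteq> 0"
    and cond: "maximal_even n S \<or> coprime r (Determinant.det S)"
    and \<alpha>: "\<alpha> = Gcd {R $$ (i, 0) | i. i < n + 4}"
  shows "\<alpha> dvd r" "\<exists>M\<in>eichler_group n S. M *\<^sub>v col R 0 = \<alpha> \<cdot>\<^sub>v unit_vec (n + 4) 0"
proof -
  have R: "R \<in> carrier_mat (n + 4) (n + 4)" using sim by (rule similitude_carrier)
  define h where "h = (\<lambda>k. R $$ (k, 0))"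
  have hh: "B h h = 0"
    using similitude_col[OF sim, of 0 0] B_unitf(1) by (simp add: h_def unitf_def)
  have hl: "B h (\<lambda>k. R $$ (k, n + 3)) = r"
    using similitude_col[OF sim, of 0 "n + 3"] B_unitf(1) by (simp add: h_def unitf_def)
  have \<alpha>_dvd: "\<alpha> dvd h i" if "i < n + 4" for i
    using that unfolding \<alpha> h_def by (intro Gcd_dvd) auto
  show "\<alpha> dvd r" unfolding hl[symmetric] using \<alpha>_dvd by (rule dvd_B)
  with r have \<alpha>0: "\<alpha> \<noteq> 0" by auto
  define g where "g = (\<lambda>i. h i div \<alpha>)"
  have hg: "h i = \<alpha> * g i" if "i < n + 4" for i using \<alpha>_dvd[OF that] by (simp add: g_def)
  define x where "x = vec (n + 4) g"
  have x: "x \<in> carrier_vec (n + 4)" by (simp add: x_def)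
  have Bh: "B h y = \<alpha> * B (($) x) y" for y
  proof -
    have "B h y = B (\<lambda>i. \<alpha> * x $ i) y"
      using hg by (intro bform_cong) (auto simp: x_def)
    then show ?thesis by (simp add: bform_scale)
  qed
  have iso: "B (($) x) (($) x) = 0"
    using hh \<alpha>0 Bh[of h] Bh[of "($) x"] B_sym[of h "($) x"] by simp
  have "reach x (unit_vec (n + 4) 0)"
  proof (rule eichler_criterion[OF x iso])
    fix d assume d: "\<And>i. i < n + 4 \<Longrightarrow> d dvd B (unitf i) (($) x)"
    have "d dvd B y (($) x)" for y
      by (subst bform_expand, intro dvd_sum) (use d in auto)
    then have "\<alpha> * d dvd r"
      unfolding hl[symmetric] Bh B_sym[of "($) x"] by simp
    then have dr: "d dvd r" by (rule dvd_mult_right)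
    have "d dvd x $ i" if i: "i < n + 4" for i
    proof (cases "maximal_even n S")
      case True
      with maximal_even_isotropic_dvd[OF True _ d iso i] dr r show ?thesis by auto
    next
      case False
      then have "coprime r (Determinant.det S)" using cond by blast
      then have "coprime d (Determinant.det S)" by (rule coprime_divisors[OF dr dvd_refl])
      with dvd_det_mult[OF d i] show ?thesis by (simp add: coprime_dvd_mult_right_iff)
    qed
    then have "\<alpha> * d dvd h i" if "i < n + 4" for i
      using hg[OF that] that by (simp add: x_def)
    then have "\<alpha> * d dvd Gcd {R $$ (i, 0) | i. i < n + 4}"
      by (intro Gcd_greatest) (auto simp: h_def)
    then have "\<alpha> * d dvd \<alpha> * 1" by (simp add: \<alpha>)
    then show "is_unit d" using \<alpha>0 by (simp only: dvd_mult_cancel_left) auto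
  qed
  then obtain M where M: "M \<in> eichler_group n S" "unit_vec (n + 4) 0 = M *\<^sub>v x"
    by (auto simp: reach_def)
  have "col R 0 = \<alpha> \<cdot>\<^sub>v x"
    using R hg by (intro eq_vecI) (auto simp: x_def h_def)
  then have "M *\<^sub>v col R 0 = \<alpha> \<cdot>\<^sub>v unit_vec (n + 4) 0"
    unfolding M(2) using eichler_group_carrier[OF M(1)] x by (intro eq_vecI) auto
  with M(1) show "\<exists>M\<in>eichler_group n S. M *\<^sub>v col R 0 = \<alpha> \<cdot>\<^sub>v unit_vec (n + 4) 0" by blast
qed

text \<open>Row \<open>n + 3\<close> consists of the pairings of the columns with
  \<open>unitf 0\<close>, and column \<open>0\<close> is \<alpha> times this vector.\<close>

lemma last_row:
  assumes sim: "similitude (\<alpha> * \<delta>) P" and "\<alpha> \<noteq> 0"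
    and col: "\<And>i. i < n + 4 \<Longrightarrow> P $$ (i, 0) = \<alpha> * unitf 0 i" and j: "j < n + 4"
  shows "P $$ (n + 3, j) = \<delta> * unitf (n + 3) j"
proof -
  have "\<alpha> * P $$ (n + 3, j) = \<alpha> * B (unitf 0) (\<lambda>k. P $$ (k, j))" by (simp add: B_unitf)
  also have "\<dots> = B (\<lambda>k. \<alpha> * unitf 0 k) (\<lambda>k. P $$ (k, j))" by (simp add: bform_scale)
  also have "\<dots> = B (\<lambda>k. P $$ (k, 0)) (\<lambda>k. P $$ (k, j))"
    using col by (intro bform_cong) auto
  also have "\<dots> = \<alpha> * \<delta> * unitf (n + 3) j"
    using similitude_col[OF sim _ j, of 0] B_unitf(1) by (simp add: unitf_def)
  finally show ?thesis using \<open>\<alpha> \<noteq> 0\<close> by simp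
qed

lemma upper_coset_representative:
  assumes sim: "similitude (int r) R" and r: "r > 0"
    and cond: "maximal_even n S \<or> coprime (int r) (Determinant.det S)"
  shows "\<exists>M\<in>eichler_group n S. \<exists>\<alpha> \<delta> :: nat. \<alpha> > 0 \<and> \<delta> > 0 \<and> \<alpha> * \<delta> = r \<and>
     int \<alpha> = Gcd {R $$ (i, 0) | i. i < n + 4} \<and>
     (\<forall>i<n+4. (M * R) $$ (i, 0) = int \<alpha> * unitf 0 i) \<and>
     (\<forall>j<n+4. (M * R) $$ (n + 3, j) = int \<delta> * unitf (n + 3) j)"
proof -
  have R: "R \<in> carrier_mat (n + 4) (n + 4)" using sim by (rule similitude_carrier)
  define \<alpha> where "\<alpha> = nat (Gcd {R $$ (i, 0) | i. i < n + 4})"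
  have \<alpha>: "int \<alpha> = Gcd {R $$ (i, 0) | i. i < n + 4}" by (simp add: \<alpha>_def)
  have r0: "int r \<noteq> 0" using r by simp
  from first_column[OF sim r0 cond \<alpha>] obtain M where
    dvd: "int \<alpha> dvd int r" and M: "M \<in> eichler_group n S" "M *\<^sub>v col R 0 = int \<alpha> \<cdot>\<^sub>v unit_vec (n + 4) 0" by blast
  obtain \<delta> where \<delta>: "r = \<alpha> * \<delta>" using dvd by auto
  have MR: "similitude (int \<alpha> * int \<delta>) (M * R)"
    using similitude_mult[OF eichler_group_similitude[OF M(1)] sim] \<delta> by simp
  have col: "(M * R) $$ (i, 0) = int \<alpha> * unitf 0 i" if "i < n + 4" for i
  proof -
    have "(M * R) $$ (i, 0) = (M *\<^sub>v col R 0) $ i"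
      using that R eichler_group_carrier[OF M(1)] by simp
    then show ?thesis unfolding M(2) using that by (simp add: unitf_def)
  qed
  have pos: "\<alpha> > 0" "\<delta> > 0" using r \<delta> by auto
  have row: "(M * R) $$ (n + 3, j) = int \<delta> * unitf (n + 3) j" if "j < n + 4" for j
    using last_row[OF MR _ col that] pos by simp
  show ?thesis
    by (rule bexI[OF _ M(1)], rule exI[of _ \<alpha>], rule exI[of _ \<delta>]) (use pos row col \<alpha> \<delta> in blast)
qed

section \<open>Primitive columns\<close>

text \<open>For \<open>a\<close> vanishing at \<open>0\<close> and \<open>n + 3\<close>, this is the
  image of \<open>unitf 0\<close> under the transvection with \<open>e = unitf (n + 3)\<close>, that
  is, its first column (\<open>eichler_last\<close>).\<close>

definition shifted :: "(nat \<Rightarrow> int) \<Rightarrow> nat \<Rightarrow> int" where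
  "shifted a j = unitf 0 j + a j - (B a a div 2) * unitf (n + 3) j"

abbreviation transvection :: "(nat \<Rightarrow> int) \<Rightarrow> (nat \<Rightarrow> int) \<Rightarrow> int mat" where
  "transvection e a \<equiv> eichler (n + 4) G e a (B a a div 2)"

lemma eichler_last:
  assumes a: "a 0 = 0" "a (n + 3) = 0"
  shows "transvection (unitf (n + 3)) a \<in> eichler_group n S"
    and "k < n + 4 \<Longrightarrow> transvection (unitf (n + 3)) a $$ (k, 0) = shifted a k"
proof -
  have "transvection (unitf (n + 3)) a * 1\<^sub>m (n + 4) \<in> eichler_group n S"
    using a B_even unfolding B_unitf by (intro eichler_group.step eichler_group.one) (auto simp: B_unitf unitf_def)
  then show "transvection (unitf (n + 3)) a \<in> eichler_group n S" by simp
  have "B a (unitf 0) = 0" using B_sym[of a "unitf 0"] a by (simp add: B_unitf)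
  then show "transvection (unitf (n + 3)) a $$ (k, 0) = shifted a k" if "k < n + 4"
    using that B_unitf(4)[of "unitf 0"] by (simp add: eichler_def shifted_def unitf_def)
qed

lemma eichler_first:
  assumes a: "a 0 = 0" "a (n + 3) = 0"
  shows "transvection (unitf 0) a \<in> eichler_group n S"
    and "k < n + 4 \<Longrightarrow> transvection (unitf 0) a $$ (k, 0) = unitf 0 k"
    and "k < n + 4 \<Longrightarrow> transvection (unitf 0) a $$ (k, n + 3) = unitf (n + 3) k + a k - (B a a div 2) * unitf 0 k"
proof -
  have "transvection (unitf 0) a * 1\<^sub>m (n + 4) \<in> eichler_group n S"
    using a B_even by (intro eichler_group.step eichler_group.one) (auto simp: B_unitf unitf_def)
  then show "transvection (unitf 0) a \<in> eichler_group n S" by simp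
  have "B a (unitf 0) = 0" "B a (unitf (n + 3)) = 0"
    using B_sym[of a "unitf 0"] B_sym[of a "unitf (n + 3)"] a by (simp_all add: B_unitf)
  then show "transvection (unitf 0) a $$ (k, 0) = unitf 0 k" "transvection (unitf 0) a $$ (k, n + 3) = unitf (n + 3) k + a k - (B a a div 2) * unitf 0 k"
    if "k < n + 4"
    using that B_unitf(1)[of "unitf 0"] B_unitf(1)[of "unitf (n + 3)"]
    by (simp_all add: eichler_def unitf_def)
qed

lemma sum_shifted:
  "(\<Sum>j<n+4. f j * shifted a j) = f 0 + (\<Sum>j<n+4. f j * a j) - (B a a div 2) * f (n + 3)"
proof -
  have "(\<Sum>j<n+4. f j * shifted a j) = (\<Sum>j<n+4. (if j = 0 then f j else 0) + f j * a j
      - (if j = n + 3 then (B a a div 2) * f j else 0))"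
    by (intro sum.cong) (auto simp: shifted_def unitf_def algebra_simps)
  also have "\<dots> = (\<Sum>j<n+4. if j = 0 then f j else 0) + (\<Sum>j<n+4. f j * a j)
      - (\<Sum>j<n+4. if j = n + 3 then (B a a div 2) * f j else 0)"
    by (simp only: sum.distrib sum_subtractf)
  finally show ?thesis by simp
qed

text \<open>The halved norm is the delicate term, notably for \<open>p = 2\<close>. Writing
  \<open>a = a' + p * b\<close>, evenness of \<open>B b b\<close> makes the norms differ by a
  multiple of \<open>2 * p\<close>, so their halves agree modulo \<open>p\<close>.\<close>

lemma shifted_cong:
  assumes "\<And>j. j < n + 4 \<Longrightarrow> [a j = a' j] (mod p)"
  shows "[(\<Sum>j<n+4. f j * shifted a j) = (\<Sum>j<n+4. f j * shifted a' j)] (mod p)"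
proof -
  define b where "b = (\<lambda>j. (a j - a' j) div p)"
  have ab: "a j = a' j + p * b j" if "j < n + 4" for j
    using assms[OF that] by (simp add: b_def cong_iff_dvd_diff)
  obtain k l where k: "B a' a' = 2 * k" and l: "B b b = 2 * l"
    using B_even[of a'] B_even[of b] by (auto simp: dvd_def)
  have "B a a = B (\<lambda>j. a' j + p * b j) (\<lambda>j. a' j + p * b j)"
    using ab by (intro bform_cong) auto
  also have "\<dots> = 2 * (k + p * (B a' b + p * l))"
    by (simp only: bform_linear bform_scale k l B_sym[of b a']) (simp add: algebra_simps)
  finally have "B a a div 2 = B a' a' div 2 + p * (B a' b + p * l)" using k by simp
  then have "[B a a div 2 = B a' a' div 2] (mod p)" by (simp add: cong_iff_dvd_diff)
  then show ?thesis
    unfolding sum_shifted using assms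
    by (intro cong_diff cong_add cong_mult cong_sum cong_refl) auto
qed

text \<open>The vectors \<open>shifted a\<close> span modulo every prime: polarising the quadratic term
  isolates the last column of \<open>R\<close>, and then the linear term gives all the others.\<close>

lemma shifted_nonzero_mod_prime:
  assumes prim: "\<And>d. (\<And>i j. i < n + 4 \<Longrightarrow> j < n + 4 \<Longrightarrow> d dvd R $$ (i, j)) \<Longrightarrow> is_unit d"
    and p: "\<not> is_unit p"
  shows "\<exists>a i. a 0 = 0 \<and> a (n + 3) = 0 \<and> i < n + 4 \<and> \<not> p dvd (\<Sum>j<n+4. R $$ (i, j) * shifted a j)"
proof (rule ccontr)
  assume "\<not> ?thesis"
  then have *: "p dvd R $$ (i, 0) + (\<Sum>j<n+4. R $$ (i, j) * a j) - (B a a div 2) * R $$ (i, n + 3)"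
    if "i < n + 4" "a 0 = 0" "a (n + 3) = 0" for i a
    using that unfolding sum_shifted by blast
  have unit_sum: "(\<Sum>j<n+4. R $$ (i, j) * unitf k j) = R $$ (i, k)" if "k < n + 4" for i k
    using that by (simp add: unitf_def if_distrib cong: if_cong)
  have first: "p dvd R $$ (i, 0)" if "i < n + 4" for i
    using *[OF that, of "\<lambda>_. 0"] by simp
  have iso: "p dvd R $$ (i, k)" if "i < n + 4" "k = 1 \<or> k = n + 2" for i k
  proof -
    have "B (unitf k) (unitf k) = 0" using that B_unitf(2,3) by (auto simp: unitf_def)
    moreover have "unitf k 0 = (0::int)" "unitf k (n + 3) = (0::int)" "k < n + 4"
      using that by (auto simp: unitf_def)
    ultimately show ?thesis
      using *[OF that(1), of "unitf k"] first[OF that(1)] by (simp add: unit_sum dvd_add_right_iff)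
  qed
  have last: "p dvd R $$ (i, n + 3)" if "i < n + 4" for i
  proof -
    \<comment> \<open>Two isotropic vectors with mutual pairing 1: their sum has half norm 1, so
      column \<open>n + 3\<close> enters exactly once.\<close>
    define a :: "nat \<Rightarrow> int" where "a = (\<lambda>j. unitf 1 j + unitf (n + 2) j)"
    have a: "a 0 = 0" "a (n + 3) = 0" "a 1 = 1" "a (n + 2) = 1" by (simp_all add: a_def unitf_def)
    have "B a a = B (unitf (Suc 0)) a + B (unitf (n + 2)) a" by (simp add: a_def bform_linear)
    then have "B a a = 2" unfolding B_unitf using a by simp
    moreover have "(\<Sum>j<n+4. R $$ (i, j) * a j) = R $$ (i, 1) + R $$ (i, n + 2)"
      using unit_sum[of 1 i] unit_sum[of "n + 2" i] by (simp add: a_def distrib_left sum.distrib)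
    ultimately have "p dvd R $$ (i, 0) + (R $$ (i, 1) + R $$ (i, n + 2)) - R $$ (i, n + 3)"
      using *[OF that a(1,2)] by simp
    moreover have "p dvd R $$ (i, 0) + (R $$ (i, 1) + R $$ (i, n + 2))"
      using first[OF that] iso[OF that] by (intro dvd_add) auto
    ultimately show ?thesis using dvd_diff_right_iff by blast
  qed
  have "p dvd R $$ (i, k)" if "i < n + 4" "k < n + 4" for i k
  proof (cases "k = 0 \<or> k = n + 3")
    case True
    with first last that show ?thesis by auto
  next
    case False
    then have "unitf k 0 = (0::int)" "unitf k (n + 3) = (0::int)" by (auto simp: unitf_def)
    from *[OF that(1) this] have "p dvd R $$ (i, 0) + R $$ (i, k) - (B (unitf k) (unitf k) div 2) * R $$ (i, n + 3)"
      by (simp add: unit_sum[OF that(2)])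
    moreover have "p dvd (B (unitf k) (unitf k) div 2) * R $$ (i, n + 3)"
      using last[OF that(1)] by simp
    ultimately have "p dvd R $$ (i, 0) + R $$ (i, k)" using dvd_diff_left_iff by blast
    then show ?thesis using first[OF that(1)] dvd_add_right_iff by blast
  qed
  with prim p show False by blast
qed

text \<open>The gcd of the first column of \<open>R * N\<close> divides \<open>r\<close> by
  \<open>first_column\<close>, so only the finitely many primes of \<open>r\<close> have to be
  avoided. A good vector is chosen for each of them, and \<open>shifted_cong\<close> allows them to
  be glued by congruences.\<close>

lemma primitive_column:
  assumes sim: "similitude (int r) R" and r: "r > 0"
    and cond: "maximal_even n S \<or> coprime (int r) (Determinant.det S)"
    and prim: "\<And>d. (\<And>i j. i < n + 4 \<Longrightarrow> j < n + 4 \<Longrightarrow> d dvd R $$ (i, j)) \<Longrightarrow> is_unit d"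
  shows "\<exists>N\<in>eichler_group n S. Gcd {(R * N) $$ (i, 0) | i. i < n + 4} = 1"
proof -
  have R: "R \<in> carrier_mat (n + 4) (n + 4)" using sim by (rule similitude_carrier)
  define P where "P = prime_factors r"
  define ok where "ok = (\<lambda>p a. a 0 = 0 \<and> a (n + 3) = 0 \<and>
      (\<exists>i<n+4. \<not> int p dvd (\<Sum>j<n+4. R $$ (i, j) * shifted a j)))"
  have prime: "prime p" if "p \<in> P" for p using that by (auto simp: P_def)
  have "\<exists>a. ok p a" if "p \<in> P" for p
  proof -
    have "\<not> is_unit (int p)" using prime[OF that] by (metis int_dvd_int_iff of_nat_1 not_prime_unit)
    from shifted_nonzero_mod_prime[OF prim this] show ?thesis unfolding ok_def by blast
  qed
  then obtain A where A: "ok p (A p)" if "p \<in> P" for p by metis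
  have "\<exists>x. \<forall>p\<in>P. [x = A p j] (mod int p)" for j
    using prime by (intro simultaneous_congruences) (auto simp: P_def)
  then obtain x where x: "[x j = A p j] (mod int p)" if "p \<in> P" for p j by metis
  \<comment> \<open>Resetting the outer coordinates to 0 keeps the congruences, since every
    \<open>A p\<close> is 0 there.\<close>
  define a where "a = (\<lambda>j. if j = 0 \<or> j = n + 3 then 0 else x j)"
  have a: "a 0 = 0" "a (n + 3) = 0" by (simp_all add: a_def)
  have cong: "[a j = A p j] (mod int p)" if "p \<in> P" for p j
    using A[OF that] x[OF that] by (auto simp: a_def ok_def)
  define N where "N = eichler (n + 4) G (unitf (n + 3)) a (B a a div 2)"
  have N: "N \<in> eichler_group n S" "N \<in> carrier_mat (n + 4) (n + 4)"
    using eichler_last(1)[of a, OF a] by (simp_all add: N_def)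
  have col: "(R * N) $$ (i, 0) = (\<Sum>j<n+4. R $$ (i, j) * shifted a j)" if "i < n + 4" for i
  proof -
    have "(R * N) $$ (i, 0) = (\<Sum>j<n+4. R $$ (i, j) * N $$ (j, 0))"
      using R N that by (simp add: scalar_prod_def atLeast0LessThan)
    also have "\<dots> = (\<Sum>j<n+4. R $$ (i, j) * shifted a j)"
      using eichler_last(2)[of a, OF a] by (intro sum.cong) (auto simp: N_def)
    finally show ?thesis .
  qed
  have sim': "similitude (int r) (R * N)"
    using similitude_mult[OF sim eichler_group_similitude[OF N(1)]] by simp
  define \<alpha> where "\<alpha> = Gcd {(R * N) $$ (i, 0) | i. i < n + 4}"
  have \<alpha>r: "\<alpha> dvd int r" using first_column(1)[OF sim' _ cond \<alpha>_def] r by simp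
  have "is_unit \<alpha>"
  proof (rule ccontr)
    assume "\<not> is_unit \<alpha>"
    moreover have "\<alpha> \<noteq> 0" using \<alpha>r r by auto
    ultimately obtain q where q: "prime q" "q dvd \<alpha>" by (metis prime_divisor_exists)
    define p where "p = nat q"
    have qp: "q = int p" using prime_gt_0_int[OF q(1)] by (simp add: p_def)
    have "p dvd r" using q(2) \<alpha>r qp by (metis dvd_trans int_dvd_int_iff)
    then have p: "p \<in> P" using q(1) r qp by (simp add: P_def in_prime_factors_iff)
    then obtain i where i: "i < n + 4" "\<not> int p dvd (\<Sum>j<n+4. R $$ (i, j) * shifted (A p) j)"
      using A by (auto simp: ok_def)
    have "\<alpha> dvd (R * N) $$ (i, 0)" unfolding \<alpha>_def using i(1) by (intro Gcd_dvd) auto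
    then have "int p dvd (\<Sum>j<n+4. R $$ (i, j) * shifted a j)"
      using q(2) qp col[OF i(1)] by (metis dvd_trans)
    moreover have "[(\<Sum>j<n+4. R $$ (i, j) * shifted a j) = (\<Sum>j<n+4. R $$ (i, j) * shifted (A p) j)] (mod int p)"
      using cong[OF p] by (intro shifted_cong)
    ultimately show False using i(2) cong_dvd_iff by blast
  qed
  moreover have "\<alpha> \<ge> 0" by (simp add: \<alpha>_def)
  ultimately have "\<alpha> = 1" by simp
  with N(1) show ?thesis by (auto simp: \<alpha>_def)
qed

text \<open>The last column of the inverse of \<open>P\<close>, multiplied by \<open>r\<close>, is \<open>G\<close>-dual to the first row of \<open>P\<close>.
  It is isotropic, so the hypothesis on \<open>S\<close> and \<open>r\<close> makes it integral.\<close>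

lemma integral_preimage:
  assumes sim: "similitude (int r) P" and r: "r > 0"
    and cond: "maximal_even n S \<or> coprime (int r) (Determinant.det S)"
  shows "\<exists>\<mu>. (\<forall>i<n+4. B (unitf i) \<mu> = P $$ (0, i)) \<and> B \<mu> \<mu> = 0 \<and>
     (\<forall>i<n+4. (\<Sum>j<n+4. P $$ (i, j) * \<mu> j) = int r * unitf (n + 3) i)"
proof -
  have P: "P \<in> carrier_mat (n + 4) (n + 4)" using sim by (rule similitude_carrier)
  have PG: "P\<^sup>T * G * P = int r \<cdot>\<^sub>m G" using sim similitude_iff[OF P] by blast
  have det2: "Determinant.det P ^ 2 = int r ^ (n + 4)"
    by (rule similitude_det_square[OF G_carrier P PG det_G_nonzero])
  define D where "D = Determinant.det S"
  define \<rho> where "\<rho> = (\<lambda>i. P $$ (0, i))"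
  define z where "z = vec n (\<lambda>k. \<rho> (k + 2))"
  \<comment> \<open>\<open>y\<close> is \<open>D\<close> times the rational vector whose pairings
    are the entries of \<rho>: the hyperbolic coordinates are swapped, and the middle part is solved
    by the adjugate of \<open>S\<close>, with the sign of \<open>-S\<close>.\<close>
  define y where "y = (\<lambda>i. if i = 0 then D * \<rho> (n + 3) else if i = n + 3 then D * \<rho> 0
     else if i = 1 then D * \<rho> (n + 2) else if i = n + 2 then D * \<rho> 1
     else - (adj_mat S *\<^sub>v z) $ (i - 2))"
  have D0: "D \<noteq> 0" using det_S_nonzero by (simp add: D_def)
  have Sadj: "(\<Sum>k<n. S $$ (j, k) * (adj_mat S *\<^sub>v z) $ k) = D * \<rho> (j + 2)" if "j < n" for j
  proof -
    have "(\<Sum>k<n. S $$ (j, k) * (adj_mat S *\<^sub>v z) $ k) = (S *\<^sub>v (adj_mat S *\<^sub>v z)) $ j"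
      using that adj_mat(1)[OF S_carrier] by (simp add: scalar_prod_def atLeast0LessThan)
    also have "S *\<^sub>v (adj_mat S *\<^sub>v z) = (S * adj_mat S) *\<^sub>v z"
      using adj_mat(1)[OF S_carrier] by (intro assoc_mult_mat_vec[symmetric]) (auto simp: z_def)
    also have "S * adj_mat S = adj_mat S * S"
      using adj_mat[OF S_carrier] by simp
    also have "(adj_mat S * S) *\<^sub>v z = adj_mat S *\<^sub>v (S *\<^sub>v z)"
      using adj_mat(1)[OF S_carrier] by (intro assoc_mult_mat_vec) (auto simp: z_def)
    also have "\<dots> $ j = D * z $ j"
      unfolding D_def using that by (intro adj_mat_mult_vec) (auto simp: z_def)
    finally show ?thesis using that by (simp add: z_def)
  qed
  have By: "B (unitf i) y = D * \<rho> i" if "i < n + 4" for i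
  proof (rule index_cases[OF that])
    fix j assume j: "j < n" "i = j + 2"
    have "B (unitf (j + 2)) y = (\<Sum>k<n. S $$ (j, k) * (adj_mat S *\<^sub>v z) $ k)"
      unfolding B_unitf(5)[OF j(1)] by (simp add: y_def sum_negf[symmetric])
    then show ?thesis using j Sadj by simp
  qed (use B_unitf(1-4)[of y] in \<open>auto simp: y_def\<close>)
  have By': "B x y = D * (\<Sum>i<n+4. \<rho> i * x i)" for x
    unfolding bform_expand[of _ _ x] using By by (simp add: sum_distrib_left mult_ac)
  define yv where "yv = vec (n + 4) y"
  have Py_sum: "(P *\<^sub>v yv) $ i = (\<Sum>j<n+4. P $$ (i, j) * y j)" if "i < n + 4" for i
    using that P by (simp add: yv_def scalar_prod_def atLeast0LessThan)
  \<comment> \<open>\<open>w\<close> is the error in the claimed value of \<open>P\<close> times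
    \<open>yv\<close>. It is orthogonal to all columns of \<open>P\<close>, hence 0, since
    \<open>P\<close> and \<open>G\<close> have nonzero determinant.\<close>
  define w where "w = vec (n + 4) (\<lambda>i. (P *\<^sub>v yv) $ i - D * int r * unitf (n + 3) i)"
  have Bw: "B (\<lambda>k. P $$ (k, j)) (($) w) = 0" if j: "j < n + 4" for j
  proof -
    have "B (\<lambda>k. P $$ (k, j)) (($) w) = B (\<lambda>k. P $$ (k, j)) (\<lambda>i. (P *\<^sub>v yv) $ i - D * int r * unitf (n + 3) i)"
      by (intro bform_cong) (auto simp: w_def)
    also have "\<dots> = B (\<lambda>k. P $$ (k, j)) (($) (P *\<^sub>v yv)) - D * int r * B (\<lambda>k. P $$ (k, j)) (unitf (n + 3))"
      by (simp add: bform_linear bform_scale)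
    also have "B (\<lambda>k. P $$ (k, j)) (unitf (n + 3)) = \<rho> j"
      by (subst B_sym) (simp add: B_unitf \<rho>_def)
    also have "B (\<lambda>k. P $$ (k, j)) (($) (P *\<^sub>v yv)) = B (($) (P *\<^sub>v unit_vec (n + 4) j)) (($) (P *\<^sub>v yv))"
      using j P by (intro bform_cong) (auto simp: scalar_prod_right_unit)
    also have "\<dots> = int r * B (($) (unit_vec (n + 4) j)) (($) yv)"
      by (intro bform_mult_mat_vec[OF G_carrier P PG]) (auto simp: yv_def)
    also have "B (($) (unit_vec (n + 4) j)) (($) yv) = B (unitf j) y"
      by (intro bform_cong) (auto simp: yv_def unitf_def unit_vec_def)
    finally show ?thesis using By[OF j] by simp
  qed
  have w: "w \<in> carrier_vec (n + 4)" by (simp add: w_def)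
  have "P\<^sup>T *\<^sub>v (G *\<^sub>v w) = 0\<^sub>v (n + 4)"
  proof (rule eq_vecI)
    fix j assume "j < dim_vec (0\<^sub>v (n + 4))"
    then have j: "j < n + 4" by simp
    have "(P\<^sup>T *\<^sub>v (G *\<^sub>v w)) $ j = (\<Sum>k<n+4. P $$ (k, j) * (G *\<^sub>v w) $ k)"
      using j P by (simp add: scalar_prod_def atLeast0LessThan)
    also have "\<dots> = (\<Sum>k<n+4. P $$ (k, j) * B (unitf k) (($) w))"
      using G_mult_vec[OF w] by (intro sum.cong) auto
    also have "\<dots> = 0" using Bw[OF j] bform_expand[of "n + 4" G "\<lambda>k. P $$ (k, j)" "($) w"] by simp
    finally show "(P\<^sup>T *\<^sub>v (G *\<^sub>v w)) $ j = 0\<^sub>v (n + 4) $ j" using j by simp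
  qed (use P in simp)
  moreover have "Determinant.det (P\<^sup>T) \<noteq> 0"
    using det2 r det_transpose[OF P] by auto
  moreover have "G *\<^sub>v w \<in> carrier_vec (n + 4)" "P\<^sup>T \<in> carrier_mat (n + 4) (n + 4)"
    using P mult_mat_vec_carrier[OF G_carrier w] by auto
  ultimately have "w = 0\<^sub>v (n + 4)"
    using w det_0_iff_vec_prod_zero[of "P\<^sup>T" "n + 4"] det_0_iff_vec_prod_zero[OF G_carrier] det_G_nonzero by blast
  then have w0: "w $ i = 0" if "i < n + 4" for i using that by simp
  have Py: "(P *\<^sub>v yv) $ i = D * int r * unitf (n + 3) i" if "i < n + 4" for i
    using w0[OF that] unfolding w_def index_vec[OF that] by linarith
  \<comment> \<open>Row \<open>0\<close> of \<open>P\<close> is \<rho>, so coordinate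
    \<open>0\<close> of the image of \<open>y\<close> is this sum, and \<open>B y y\<close> is
    \<open>D\<close> times it.\<close>
  have "(\<Sum>i<n+4. \<rho> i * y i) = 0"
    using Py[of 0] Py_sum[of 0] by (simp add: \<rho>_def unitf_def)
  then have iso: "B y y = 0" using By' by simp
  have "D dvd y i" if i: "i < n + 4" for i
  proof (cases "maximal_even n S")
    case True
    show ?thesis by (rule maximal_even_isotropic_dvd[OF True D0 _ iso i]) (simp add: By)
  next
    case False
    then have "coprime (int r) D" using cond by (simp add: D_def)
    \<comment> \<open>The square of \<open>det P\<close> is a power of \<open>r\<close>, so
      \<open>D\<close> is coprime to \<open>det P\<close>. As \<open>D\<close> divides the image of
      \<open>y\<close> under \<open>P\<close>, the adjugate of \<open>P\<close> transfers the
      divisibility to \<open>y\<close>.\<close>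
    then have "coprime (Determinant.det P ^ 2) D" unfolding det2 by simp
    then have "coprime D (Determinant.det P)" by (simp add: coprime_commute)
    moreover have "D dvd Determinant.det P * y i"
    proof -
      have "Determinant.det P * y i = (adj_mat P *\<^sub>v (P *\<^sub>v yv)) $ i"
        using adj_mat_mult_vec[OF P _ i, of yv] i by (simp add: yv_def)
      also have "\<dots> = (\<Sum>k<n+4. adj_mat P $$ (i, k) * (P *\<^sub>v yv) $ k)"
        using i P adj_mat(1)[OF P] by (simp add: scalar_prod_def atLeast0LessThan)
      also have "D dvd \<dots>" using Py by (intro dvd_sum) auto
      finally show ?thesis .
    qed
    ultimately show ?thesis by (simp add: coprime_dvd_mult_right_iff)
  qed
  define \<mu> where "\<mu> = (\<lambda>i. y i div D)"
  have y\<mu>: "y i = D * \<mu> i" if "i < n + 4" for i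
    using \<open>\<And>i. i < n + 4 \<Longrightarrow> D dvd y i\<close>[OF that] by (simp add: \<mu>_def)
  have B\<mu>: "B x y = D * B x \<mu>" for x
  proof -
    have "B x y = B x (\<lambda>i. D * \<mu> i)" using y\<mu> by (intro bform_cong) auto
    then show ?thesis by (simp add: bform_scale)
  qed
  have "B (unitf i) \<mu> = P $$ (0, i)" if "i < n + 4" for i
    using By[OF that] B\<mu> D0 by (simp add: \<rho>_def)
  moreover have "B \<mu> \<mu> = 0"
    using iso B\<mu>[of y] B\<mu>[of \<mu>] B_sym[of y \<mu>] D0 by simp
  moreover have "(\<Sum>j<n+4. P $$ (i, j) * \<mu> j) = int r * unitf (n + 3) i" if "i < n + 4" for i
  proof -
    have "D * (\<Sum>j<n+4. P $$ (i, j) * \<mu> j) = (\<Sum>j<n+4. P $$ (i, j) * y j)"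
      using y\<mu> by (simp add: sum_distrib_left mult_ac)
    then show ?thesis using Py[OF that] Py_sum[OF that] D0 by simp
  qed
  ultimately show ?thesis by blast
qed

section \<open>Representatives of double cosets\<close>

lemma primitive_double_coset_representative:
  assumes sim: "similitude (int r) R" and r: "r > 0"
    and cond: "maximal_even n S \<or> coprime (int r) (Determinant.det S)"
    and prim: "\<And>d. (\<And>i j. i < n + 4 \<Longrightarrow> j < n + 4 \<Longrightarrow> d dvd R $$ (i, j)) \<Longrightarrow> is_unit d"
  shows "\<exists>M\<in>eichler_group n S. \<exists>N\<in>eichler_group n S.
    (\<forall>i<n+4. (M * R * N) $$ (i, 0) = unitf 0 i \<and> (M * R * N) $$ (i, n + 3) = int r * unitf (n + 3) i \<and>
       (M * R * N) $$ (0, i) = unitf 0 i \<and> (M * R * N) $$ (n + 3, i) = int r * unitf (n + 3) i)"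
proof -
  have R: "R \<in> carrier_mat (n + 4) (n + 4)" using sim by (rule similitude_carrier)
  obtain N1 where N1: "N1 \<in> eichler_group n S" "Gcd {(R * N1) $$ (i, 0) | i. i < n + 4} = 1"
    using primitive_column[OF assms] by blast
  have sim1: "similitude (int r) (R * N1)"
    using similitude_mult[OF sim eichler_group_similitude[OF N1(1)]] by simp
  obtain M \<alpha> where M: "M \<in> eichler_group n S" and "int \<alpha> = 1"
    and "\<forall>i<n+4. (M * (R * N1)) $$ (i, 0) = int \<alpha> * unitf 0 i"
    using upper_coset_representative[OF sim1 r cond] unfolding N1(2) by blast
  then have col: "(M * (R * N1)) $$ (i, 0) = unitf 0 i" if "i < n + 4" for i using that by simp
  define P where "P = M * (R * N1)"
  have simP: "similitude (int r) P"
    using similitude_mult[OF eichler_group_similitude[OF M] sim1] by (simp add: P_def)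
  have P: "P \<in> carrier_mat (n + 4) (n + 4)" using simP by (rule similitude_carrier)
  obtain \<mu> where \<mu>: "\<And>i. i < n + 4 \<Longrightarrow> B (unitf i) \<mu> = P $$ (0, i)" "B \<mu> \<mu> = 0"
    "\<And>i. i < n + 4 \<Longrightarrow> (\<Sum>j<n+4. P $$ (i, j) * \<mu> j) = int r * unitf (n + 3) i"
    using integral_preimage[OF simP r cond] by blast
  have \<mu>3: "\<mu> (n + 3) = 1"
    using \<mu>(1)[of 0] col[of 0] by (simp add: B_unitf P_def unitf_def)
  define a where "a = (\<lambda>i. if i = 0 \<or> i = n + 3 then 0 else \<mu> i)"
  have a: "a 0 = 0" "a (n + 3) = 0" by (simp_all add: a_def)
  have "bform n S (\<lambda>i. a (i + 2)) (\<lambda>i. a (i + 2)) = bform n S (\<lambda>i. \<mu> (i + 2)) (\<lambda>i. \<mu> (i + 2))"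
    by (intro bform_cong) (auto simp: a_def)
  then have "B \<mu> \<mu> = 2 * \<mu> 0 + B a a"
    unfolding B_eq using \<mu>3 by (simp add: a_def)
  \<comment> \<open>Isotropy together with \<open>\<mu> (n + 3) = 1\<close> forces coordinate
    \<open>0\<close> to be the one produced by a transvection, so \<mu> is the image of
    \<open>unitf (n + 3)\<close>.\<close>
  then have \<mu>0: "\<mu> 0 = - (B a a div 2)" using \<mu>(2) by linarith
  define N2 where "N2 = eichler (n + 4) G (unitf 0) a (B a a div 2)"
  have N2: "N2 \<in> eichler_group n S" "\<And>k. k < n + 4 \<Longrightarrow> N2 $$ (k, 0) = unitf 0 k"
    using eichler_first(1,2)[of a, OF a] by (simp_all add: N2_def)
  have N2_last: "N2 $$ (k, n + 3) = \<mu> k" if "k < n + 4" for k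
    unfolding N2_def eichler_first(3)[of a, OF a that]
    using \<mu>0 \<mu>3 by (auto simp: a_def unitf_def)
  have N2c: "N2 \<in> carrier_mat (n + 4) (n + 4)" using N2(1) by (rule eichler_group_carrier)
  \<comment> \<open>\<open>N2\<close> fixes \<open>unitf 0\<close> and has last column \<mu>: the
    first column of \<open>P\<close> is kept, and the last one becomes \<open>r\<close> times
    \<open>unitf (n + 3)\<close>. The outer rows then follow from the similitude relation.\<close>
  define Q where "Q = P * N2"
  have simQ: "similitude (int r) Q"
    using similitude_mult[OF simP eichler_group_similitude[OF N2(1)]] by (simp add: Q_def)
  have Q_sum: "Q $$ (i, j) = (\<Sum>k<n+4. P $$ (i, k) * N2 $$ (k, j))" if "i < n + 4" "j < n + 4" for i j
    using that P N2c by (simp add: Q_def scalar_prod_def atLeast0LessThan)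
  have Q0: "Q $$ (i, 0) = unitf 0 i" if "i < n + 4" for i
  proof -
    have "Q $$ (i, 0) = (\<Sum>k<n+4. P $$ (i, k) * unitf 0 k)"
      using that N2(2) by (simp add: Q_sum)
    also have "\<dots> = P $$ (i, 0)" by (simp add: unitf_def if_distrib cong: if_cong)
    finally show ?thesis using col[OF that] by (simp add: P_def)
  qed
  have Q3: "Q $$ (i, n + 3) = int r * unitf (n + 3) i" if "i < n + 4" for i
    using that \<mu>(3)[OF that] N2_last by (simp add: Q_sum)
  have Q_last: "Q $$ (n + 3, j) = int r * unitf (n + 3) j" if "j < n + 4" for j
    by (rule last_row[of 1, OF _ _ _ that]) (use simQ Q0 in auto)
  have Q_first: "Q $$ (0, j) = unitf 0 j" if j: "j < n + 4" for j
  proof -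
    have "int r * Q $$ (0, j) = int r * B (unitf (n + 3)) (\<lambda>k. Q $$ (k, j))" by (simp add: B_unitf)
    also have "\<dots> = B (\<lambda>k. int r * unitf (n + 3) k) (\<lambda>k. Q $$ (k, j))" by (simp add: bform_scale)
    also have "\<dots> = B (\<lambda>k. Q $$ (k, n + 3)) (\<lambda>k. Q $$ (k, j))"
      using Q3 by (intro bform_cong) auto
    also have "\<dots> = int r * unitf 0 j"
      using similitude_col[OF simQ _ j, of "n + 3"] B_unitf(4) by (simp add: unitf_def)
    finally show ?thesis using r by simp
  qed
  have "M * R * (N1 * N2) = Q"
  proof -
    note Mc = eichler_group_carrier[OF M] and N1c = eichler_group_carrier[OF N1(1)]
    have "M * R * (N1 * N2) = M * R * N1 * N2"
      using Mc N1c N2c R by (intro assoc_mult_mat[symmetric, of _ "n + 4" "n + 4" _ "n + 4"]) auto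
    also have "M * R * N1 = P"
      unfolding P_def using Mc N1c R by (intro assoc_mult_mat[of _ "n + 4" "n + 4" _ "n + 4"]) auto
    finally show ?thesis by (simp add: Q_def)
  qed
  with Q0 Q3 Q_first Q_last show ?thesis
    by (intro bexI[OF _ M] bexI[OF _ eichler_group_mult[OF N1(1) N2(1)]]) auto
qed

text \<open>Dividing by the gcd \<alpha> of the entries leaves a primitive similitude, whose reduced
  form is multiplied back by \<alpha>. Coprimality to \<open>det S\<close> passes from
  \<open>r\<close> to the divisor \<open>s\<close>.\<close>

lemma double_coset_representative:
  assumes sim: "similitude (int r) R" and r: "r > 0"
    and cond: "maximal_even n S \<or> coprime (int r) (Determinant.det S)"
  shows "\<exists>M\<in>eichler_group n S. \<exists>N\<in>eichler_group n S. \<exists>(\<alpha> :: nat) (s :: nat). \<exists>Q\<in>carrier_mat (n + 4) (n + 4).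
    M * R * N = int \<alpha> \<cdot>\<^sub>m Q \<and> \<alpha> > 0 \<and> \<alpha> * (\<alpha> * s) = r \<and>
    int \<alpha> = Gcd {R $$ (i, j) | i j. i < n + 4 \<and> j < n + 4} \<and>
    (\<forall>i<n+4. Q $$ (i, 0) = unitf 0 i \<and> Q $$ (i, n + 3) = int s * unitf (n + 3) i \<and>
       Q $$ (0, i) = unitf 0 i \<and> Q $$ (n + 3, i) = int s * unitf (n + 3) i)"
proof -
  have R: "R \<in> carrier_mat (n + 4) (n + 4)" using sim by (rule similitude_carrier)
  define \<alpha> where "\<alpha> = nat (Gcd {R $$ (i, j) | i j. i < n + 4 \<and> j < n + 4})"
  have \<alpha>: "int \<alpha> = Gcd {R $$ (i, j) | i j. i < n + 4 \<and> j < n + 4}" by (simp add: \<alpha>_def)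
  have dvd: "int \<alpha> dvd R $$ (i, j)" if "i < n + 4" "j < n + 4" for i j
    unfolding \<alpha> using that by (intro Gcd_dvd) auto
  define R' where "R' = mat (n + 4) (n + 4) (\<lambda>(i, j). R $$ (i, j) div int \<alpha>)"
  have R': "R' \<in> carrier_mat (n + 4) (n + 4)" by (simp add: R'_def)
  have RR': "R $$ (i, j) = int \<alpha> * R' $$ (i, j)" if "i < n + 4" "j < n + 4" for i j
    using dvd[OF that] that by (simp add: R'_def)
  have R_smult: "R = int \<alpha> \<cdot>\<^sub>m R'" using R R' RR' by (intro eq_matI) auto
  have Bcol: "B (\<lambda>k. R $$ (k, i)) (\<lambda>k. R $$ (k, j)) =
      int \<alpha> * (int \<alpha> * B (\<lambda>k. R' $$ (k, i)) (\<lambda>k. R' $$ (k, j)))" if "i < n + 4" "j < n + 4" for i j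
  proof -
    have "B (\<lambda>k. R $$ (k, i)) (\<lambda>k. R $$ (k, j)) = B (\<lambda>k. int \<alpha> * R' $$ (k, i)) (\<lambda>k. int \<alpha> * R' $$ (k, j))"
      using that RR' by (intro bform_cong) auto
    then show ?thesis by (simp add: bform_scale)
  qed
  \<comment> \<open>Reading the new factor off as the pairing of columns \<open>0\<close> and
    \<open>n + 3\<close> shows that it is an integer; bilinearity gives
    \<open>r = \<alpha> * \<alpha> * s\<close>.\<close>
  define s where "s = B (\<lambda>k. R' $$ (k, 0)) (\<lambda>k. R' $$ (k, n + 3))"
  have rs: "int r = int \<alpha> * (int \<alpha> * s)"
    using similitude_col[OF sim, of 0 "n + 3"] Bcol[of 0 "n + 3"] B_unitf(1)[of "unitf (n + 3)"]
    by (simp add: s_def unitf_def)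
  have \<alpha>0: "\<alpha> > 0" using rs r by (cases "\<alpha> = 0") auto
  have s0: "s > 0"
    using rs r \<alpha>0 by (metis of_nat_0_less_iff zero_less_mult_pos)
  have ns: "int (nat s) = s" using s0 by simp
  have sim': "similitude (int (nat s)) R'"
    unfolding similitude_def ns
  proof (intro conjI allI impI R')
    fix i j assume ij: "i < n + 4" "j < n + 4"
    have "B (\<lambda>k. R $$ (k, i)) (\<lambda>k. R $$ (k, j)) = int r * G $$ (i, j)"
      using sim ij by (simp add: similitude_def)
    then have "int \<alpha> * (int \<alpha> * B (\<lambda>k. R' $$ (k, i)) (\<lambda>k. R' $$ (k, j))) = int \<alpha> * (int \<alpha> * (s * G $$ (i, j)))"
      by (simp only: Bcol[OF ij] rs mult.assoc)
    then show "B (\<lambda>k. R' $$ (k, i)) (\<lambda>k. R' $$ (k, j)) = s * G $$ (i, j)" using \<alpha>0 by simp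
  qed
  have cond': "maximal_even n S \<or> coprime (int (nat s)) (Determinant.det S)"
  proof (rule disjE[OF cond])
    assume "coprime (int r) (Determinant.det S)"
    moreover have "s dvd int r" by (simp add: rs)
    ultimately have "coprime s (Determinant.det S)"
      using coprime_divisors[of s "int r" "Determinant.det S" "Determinant.det S"] by simp
    then show ?thesis unfolding ns by (rule disjI2)
  qed simp
  have prim: "is_unit d" if d: "\<And>i j. i < n + 4 \<Longrightarrow> j < n + 4 \<Longrightarrow> d dvd R' $$ (i, j)" for d
  proof -
    have "int \<alpha> * d dvd Gcd {R $$ (i, j) | i j. i < n + 4 \<and> j < n + 4}"
      using d RR' by (intro Gcd_greatest) auto
    then have "int \<alpha> * d dvd int \<alpha> * 1" by (simp only: \<alpha> mult_1_right)
    then show ?thesis using \<alpha>0 by (simp only: dvd_mult_cancel_left) auto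
  qed
  obtain M N where M: "M \<in> eichler_group n S" and N: "N \<in> eichler_group n S"
    and Q: "\<forall>i<n+4. (M * R' * N) $$ (i, 0) = unitf 0 i \<and> (M * R' * N) $$ (i, n + 3) = int (nat s) * unitf (n + 3) i \<and>
       (M * R' * N) $$ (0, i) = unitf 0 i \<and> (M * R' * N) $$ (n + 3, i) = int (nat s) * unitf (n + 3) i"
    using primitive_double_coset_representative[OF sim' _ cond' prim] s0 by (metis zero_less_nat_eq)
  note Mc = eichler_group_carrier[OF M] and Nc = eichler_group_carrier[OF N]
  have "M * R * N = int \<alpha> \<cdot>\<^sub>m (M * R' * N)"
    unfolding R_smult mult_smult_distrib[OF Mc R']
    by (rule mult_smult_assoc_mat[OF mult_carrier_mat[OF Mc R'] Nc])
  moreover have "\<alpha> * (\<alpha> * nat s) = r"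
    using rs ns by (metis of_nat_eq_iff of_nat_mult)
  moreover have "M * R' * N \<in> carrier_mat (n + 4) (n + 4)" using Mc Nc R' by simp
  ultimately show ?thesis
    using M N \<alpha>0 \<alpha> Q by blast
qed

section \<open>From real isometries to integral similitudes\<close>

lemma similitude_of_SO_plus:
  assumes r: "r > 0" and R: "R \<in> carrier_mat (n + 4) (n + 4)"
    and SO: "(1 / sqrt (real r)) \<cdot>\<^sub>m real_mat R \<in> SO_plus (n + 4) (real_mat G)"
  shows "similitude (int r) R"
  unfolding similitude_def
proof (intro conjI allI impI R)
  fix i j assume ij: "i < n + 4" "j < n + 4"
  let ?c = "1 / sqrt (real r)"
  let ?M = "?c \<cdot>\<^sub>m real_mat R"
  have G: "real_mat G \<in> carrier_mat (n + 4) (n + 4)" by simp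
  have M: "?M \<in> carrier_mat (n + 4) (n + 4)" using R by simp
  have "?M \<in> SO_real (n + 4) (real_mat G)" using SO SO_plus_subset by blast
  then have "?M\<^sup>T * real_mat G * ?M = real_mat G" by (simp add: SO_real_def)
  then have "real_of_int (G $$ (i, j)) = bform (n + 4) (real_mat G) (\<lambda>k. ?M $$ (k, i)) (\<lambda>k. ?M $$ (k, j))"
    using transpose_mult_bform[OF G M ij] ij by simp
  also have "\<dots> = bform (n + 4) (real_mat G) (\<lambda>k. ?c * of_int (R $$ (k, i))) (\<lambda>k. ?c * of_int (R $$ (k, j)))"
    using ij R by (intro bform_cong) auto
  also have "\<dots> = ?c * (?c * of_int (B (\<lambda>k. R $$ (k, i)) (\<lambda>k. R $$ (k, j))))"
    by (simp only: bform_scale of_int_bform[OF G_carrier])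
  \<comment> \<open>One factor \<open>1 / sqrt r\<close> comes from each argument of the form, so
    together they contribute \<open>1 / r\<close> and the relation becomes integral.\<close>
  also have "\<dots> = of_int (B (\<lambda>k. R $$ (k, i)) (\<lambda>k. R $$ (k, j))) / real r"
    using r by (simp add: field_simps flip: power2_eq_square)
  finally have "real_of_int (B (\<lambda>k. R $$ (k, i)) (\<lambda>k. R $$ (k, j))) = of_int (int r * G $$ (i, j))"
    using r by (simp add: field_simps)
  then show "B (\<lambda>k. R $$ (k, i)) (\<lambda>k. R $$ (k, j)) = int r * G $$ (i, j)"
    by (simp only: of_int_eq_iff)
qed

end

theorem theorem2:
  fixes n r :: nat and S R :: "int mat"
  assumes S_carrier: "S \<in> carrier_mat n n"
    and S_sym: "sym_mat S"
    and S_pos_def: "pos_def_mat n S"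
    and S_even: "even_mat S"
    and r_pos: "r > 0"
    and R_carrier: "R \<in> carrier_mat (n + 4) (n + 4)"
    and R_SO_plus: "(1 / sqrt (real r)) \<cdot>\<^sub>m real_mat R \<in> SO_plus (n + 4) (real_mat (S1_mat n S))"
    and maximal_or_coprime: "maximal_even n S \<or> coprime (int r) (Determinant.det S)"
  shows "(\<exists>P \<in> right_coset (Gamma_tilde n S) R. \<exists>\<alpha> \<delta> :: nat.
            \<alpha> > 0 \<and> \<delta> > 0 \<and> \<alpha> * \<delta> = r \<and>
            int \<alpha> = Gcd {R $$ (i, 0) | i. i < n + 4} \<and>
            block_upper (n + 2) (int \<alpha>) (int \<delta>) P)
       \<and> (\<exists>Rs \<in> double_coset (Gamma_tilde n S) R.
            \<exists>(\<alpha>s :: nat) (\<delta>s :: int). \<exists>Ks \<in> carrier_mat (n + 2) (n + 2).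
            Rs = diag_block_mat [scalar_block (int \<alpha>s), Ks, scalar_block \<delta>s] \<and>
            \<alpha>s > 0 \<and> int \<alpha>s * \<delta>s = int r \<and>
            int \<alpha>s = Gcd {R $$ (i, j) | i j. i < n + 4 \<and> j < n + 4} \<and>
            (\<exists>Q \<in> carrier_mat (n + 4) (n + 4).
               real_mat Q = (1 / real \<alpha>s) \<cdot>\<^sub>m real_mat Rs))"
proof -
  interpret even_lattice n S
    using S_carrier S_sym S_pos_def S_even
    by unfold_locales (auto simp: sym_mat_def even_mat_def)
  have sim: "similitude (int r) R"
    using similitude_of_SO_plus r_pos R_carrier R_SO_plus by blast
  show ?thesis
  proof (intro conjI, goal_cases)
    case 1
    obtain M \<alpha> \<delta> where M: "M \<in> eichler_group n S"
      and \<alpha>\<delta>: "\<alpha> > 0" "\<delta> > 0" "\<alpha> * \<delta> = r" "int \<alpha> = Gcd {R $$ (i, 0) | i. i < n + 4}"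
      and col: "\<And>i. i < n + 4 \<Longrightarrow> (M * R) $$ (i, 0) = int \<alpha> * unitf 0 i"
      and row: "\<And>j. j < n + 4 \<Longrightarrow> (M * R) $$ (n + 3, j) = int \<delta> * unitf (n + 3) j"
      using upper_coset_representative[OF sim r_pos maximal_or_coprime] by blast
    have num: "n + 2 + 2 = n + 4" "n + 2 + 1 = n + 3" by simp_all
    have MR: "M * R \<in> carrier_mat (n + 4) (n + 4)"
      using eichler_group_carrier[OF M] R_carrier by simp
    have "block_upper (n + 2) (int \<alpha>) (int \<delta>) (M * R)"
      by (rule block_upperI[of "M * R" "n + 2" "int \<alpha>" "int \<delta>", unfolded num, OF MR col row])
    moreover have "M * R \<in> right_coset (Gamma_tilde n S) R"
      using M eichler_group_subset by (auto simp: right_coset_def)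
    ultimately show ?case using \<alpha>\<delta> by blast
  next
    case 2
    obtain M N Q \<alpha> s where MN: "M \<in> eichler_group n S" "N \<in> eichler_group n S"
      and Q: "Q \<in> carrier_mat (n + 4) (n + 4)" "M * R * N = int \<alpha> \<cdot>\<^sub>m Q"
      and \<alpha>: "\<alpha> > 0" "\<alpha> * (\<alpha> * s) = r" "int \<alpha> = Gcd {R $$ (i, j) | i j. i < n + 4 \<and> j < n + 4}"
      and shape: "\<And>i. i < n + 4 \<Longrightarrow> Q $$ (i, 0) = unitf 0 i \<and> Q $$ (i, n + 3) = int s * unitf (n + 3) i \<and>
        Q $$ (0, i) = unitf 0 i \<and> Q $$ (n + 3, i) = int s * unitf (n + 3) i"
      using double_coset_representative[OF sim r_pos maximal_or_coprime] by blast
    \<comment> \<open>The middle block is taken from \<alpha> times \<open>Q\<close>; the corner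
      entries are \<open>\<alpha>\<close> and \<open>\<alpha> * s\<close>, whose product is
      \<open>r\<close>.\<close>
    define K where "K = mat (n + 2) (n + 2) (\<lambda>(i, j). (int \<alpha> \<cdot>\<^sub>m Q) $$ (i + 1, j + 1))"
    have num: "n + 2 + 2 = n + 4" "n + 2 + 1 = n + 3" by simp_all
    have "int \<alpha> \<cdot>\<^sub>m Q \<in> carrier_mat (n + 4) (n + 4)" using Q(1) by simp
    moreover have "(int \<alpha> \<cdot>\<^sub>m Q) $$ (i, 0) = int \<alpha> * unitf 0 i"
      "(int \<alpha> \<cdot>\<^sub>m Q) $$ (i, n + 3) = int \<alpha> * int s * unitf (n + 3) i"
      "(int \<alpha> \<cdot>\<^sub>m Q) $$ (0, i) = int \<alpha> * unitf 0 i"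
      "(int \<alpha> \<cdot>\<^sub>m Q) $$ (n + 3, i) = int \<alpha> * int s * unitf (n + 3) i" if "i < n + 4" for i
      using Q(1) shape[OF that] that by simp_all
    ultimately have "int \<alpha> \<cdot>\<^sub>m Q = diag_block_mat [scalar_block (int \<alpha>), K, scalar_block (int \<alpha> * int s)]"
      unfolding K_def by (rule eq_diag_block_mat[of "int \<alpha> \<cdot>\<^sub>m Q" "n + 2" "int \<alpha>" "int \<alpha> * int s", unfolded num])
    moreover have "int \<alpha> \<cdot>\<^sub>m Q \<in> double_coset (Gamma_tilde n S) R"
      using MN eichler_group_subset Q(2) by (auto simp: double_coset_def) (metis subsetD)
    moreover have "real_mat Q = (1 / real \<alpha>) \<cdot>\<^sub>m real_mat (int \<alpha> \<cdot>\<^sub>m Q)"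
      using Q(1) \<alpha>(1) by (intro eq_matI) auto
    moreover have "K \<in> carrier_mat (n + 2) (n + 2)" by (simp add: K_def)
    moreover have "int \<alpha> * (int \<alpha> * int s) = int r" using \<alpha>(2) by (metis of_nat_mult)
    ultimately show ?case using Q(1) \<alpha> by blast
  qed
qed

end
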